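(* Let $\mathcal{C}\subseteq\mathbb{R}^n$ be a closed convex cone, $x_0\in\mathcal{C}$, $x_0\ne0$, $\bar x_0=x_0/\|x_0\|_2$. Let $\|\cdot\|_{(1)},\dots,\|\cdot\|_{(\tau)}$ be norms on $\mathbb{R}^n$ with Lipschitz constants $L_i$ with respect to $\|\cdot\|_2$, let $\kappa_i=\|\bar x_0\|_{(i)}/L_i$ and $\kappa_{\min}=\min_i\kappa_i$. Let $A\in\mathbb{R}^{m\times n}$ have independent $\mathcal{N}(0,1)$ entries and let $$m_{low}=\frac{(1-\bar D(\mathcal{C}))\,n\,\kappa_{\min}^2}{100}.$$ Then whenever $m\le m_{low}$, with probability at least $1-10\exp\!\left(-\tfrac1{16}\min\{m_{low},(1-\bar D(\mathcal{C}))^2n\}\right)$, $x_0$ is not a minimizer of any of the programs $$\text{minimize}_{x\in\mathcal{C}}\ h(\|x\|_{(1)},\dots,\|x\|_{(\tau)})\quad\text{subject to}\quad Ax=Ax_0,$$ where $h$ ranges over all functions $h:\mathbb{R}_+^\tau\to\mathbb{R}_+$ that are convex, non-decreasing in each argument and strictly increasing in at least one coordinate.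
   Context: For a closed convex set $\mathcal{M}\subseteq\mathbb{R}^n$, the Gaussian distance is $D(\mathcal{M})=\mathbb{E}[\inf_{v\in\mathcal{M}}\|\mathbf{h}-v\|_2]$, where $\mathbf{h}\in\mathbb{R}^n$ has independent standard normal entries, and $\bar D(\mathcal{M})=D(\mathcal{M})/\sqrt n$. The Lipschitz constant of a norm is $L=\sup_{z_1\ne z_2}\frac{\|z_1\|-\|z_2\|}{\|z_1-z_2\|_2}$. *)

theory Defs
  imports "HOL-Probability.Probability"
begin

text \<open>
  The variables of class \<open>finite\<close> index coordinates: \<open>'n\<close> those of the ambient space, \<open>'m\<close> the
  measurements (rows of the matrix) and \<open>'t\<close> the norms.
\<close>

definition is_norm :: "(real ^ 'n \<Rightarrow> real) \<Rightarrow> bool" where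
  "is_norm N \<longleftrightarrow>
     (\<forall>x. 0 \<le> N x) \<and> (\<forall>x. N x = 0 \<longleftrightarrow> x = 0) \<and>
     (\<forall>c x. N (c *\<^sub>R x) = \<bar>c\<bar> * N x) \<and> (\<forall>x y. N (x + y) \<le> N x + N y)"

definition lipschitz_const :: "(real ^ 'n \<Rightarrow> real) \<Rightarrow> real" where
  "lipschitz_const N = (SUP (z1, z2) \<in> {(z1, z2). z1 \<noteq> z2}. (N z1 - N z2) / norm (z1 - z2))"

text \<open>
  The product measure makes the coordinates of the vector independent standard normals.
  \<^const>\<open>infdist\<close> is the distance to the set, except that it is 0 for the empty set.
\<close>

definition gaussian_distance :: "(real ^ 'n) set \<Rightarrow> real" where
  "gaussian_distance S =
     (\<integral>g. infdist (\<chi> i. g i) S \<partial>(\<Pi>\<^sub>M i\<in>(UNIV :: 'n set). density lborel std_normal_density))"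

definition normalized_gaussian_distance :: "(real ^ 'n) set \<Rightarrow> real" where
  "normalized_gaussian_distance S = gaussian_distance S / sqrt (real CARD('n))"

definition kappa :: "(real ^ 'n \<Rightarrow> real) \<Rightarrow> real ^ 'n \<Rightarrow> real" where
  "kappa N x0 = N (x0 /\<^sub>R norm x0) / lipschitz_const N"

definition kappa_min :: "('t::finite \<Rightarrow> real ^ 'n \<Rightarrow> real) \<Rightarrow> real ^ 'n \<Rightarrow> real" where
  "kappa_min N x0 = (MIN i. kappa (N i) x0)"

definition m_low :: "(real ^ 'n) set \<Rightarrow> ('t::finite \<Rightarrow> real ^ 'n \<Rightarrow> real) \<Rightarrow> real ^ 'n \<Rightarrow> real" where
  "m_low C N x0 =
     (1 - normalized_gaussian_distance C) * real CARD('n) * (kappa_min N x0)\<^sup>2 / 100"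

definition std_gaussian_matrix :: "'w measure \<Rightarrow> ('w \<Rightarrow> real ^ 'n ^ 'm) \<Rightarrow> bool" where
  "std_gaussian_matrix M A \<longleftrightarrow>
     prob_space.indep_vars M (\<lambda>_. borel) (\<lambda>(i, j) \<omega>. A \<omega> $ i $ j) UNIV \<and>
     (\<forall>i j. distributed M lborel (\<lambda>\<omega>. A \<omega> $ i $ j) std_normal_density)"

text \<open>
  A function on the nonnegative orthant is represented by a total function, constrained on the
  orthant only.  Monotonicity in the argument \<open>i\<close> fixes the other entries of \<open>z\<close> and lets
  the entry \<open>i\<close> range over the nonnegative reals; the strictly increasing coordinate is the same
  for all \<open>z\<close>.
\<close>

definition nonneg_orthant :: "(real ^ 't) set" where
  "nonneg_orthant = {z. \<forall>i. 0 \<le> z $ i}"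

definition admissible :: "(real ^ 't \<Rightarrow> real) \<Rightarrow> bool" where
  "admissible h \<longleftrightarrow>
     (\<forall>z\<in>nonneg_orthant. 0 \<le> h z) \<and>
     convex_on nonneg_orthant h \<and>
     (\<forall>i. \<forall>z\<in>nonneg_orthant. mono_on {0..} (\<lambda>s. h (\<chi> j. if j = i then s else z $ j))) \<and>
     (\<exists>i. \<forall>z\<in>nonneg_orthant. strict_mono_on {0..} (\<lambda>s. h (\<chi> j. if j = i then s else z $ j)))"

definition is_minimizer ::
    "(real ^ 'n) set \<Rightarrow> ('t \<Rightarrow> real ^ 'n \<Rightarrow> real) \<Rightarrow> (real ^ 't \<Rightarrow> real) \<Rightarrow>
     real ^ 'n ^ 'm \<Rightarrow> real ^ 'n \<Rightarrow> bool" where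
  "is_minimizer C N h A x0 \<longleftrightarrow>
     is_arg_min (\<lambda>x. h (\<chi> i. N i x)) (\<lambda>x. x \<in> C \<and> A *v x = A *v x0) x0"

text \<open>
  The quantification over all admissible \<open>h\<close> is uncountable, so the set of outcomes satisfying
  \<open>P\<close> need not be obviously measurable.  Hence ``with probability at least \<open>p\<close>'' asks for a
  measurable event inside that set; for measurable \<open>P\<close> this is the usual meaning.
\<close>

definition with_prob_at_least :: "'w measure \<Rightarrow> real \<Rightarrow> ('w \<Rightarrow> bool) \<Rightarrow> bool" where
  "with_prob_at_least M p P \<longleftrightarrow>
     (\<exists>E\<in>sets M. E \<subseteq> {\<omega> \<in> space M. P \<omega>} \<and> p \<le> measure M E)"

end

theory Submission
  imports Defs
begin

text \<open>
  Let \<open>x = x0 / |x0|\<close>. A point \<open>u \<in> C\<close> with \<open>A u = A x\<close> and \<open>|u| < \<kappa>_min\<close> satisfies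
  \<open>\<parallel>u\<parallel>_i \<le> L_i |u| < \<parallel>x\<parallel>_i\<close> for every \<open>i\<close>, so \<open>|x0| u\<close> beats \<open>x0\<close> for all \<open>h\<close> at once. By separation,
  \<open>A\<close> maps \<open>C \<inter> ball 1\<close> onto a ball of radius \<open>\<rho>\<close> as soon as \<open>r v = |P_C (A\<^sup>T v)| \<ge> \<rho> |v|\<close> for all \<open>v\<close>;
  hence such a \<open>u\<close> exists if \<open>|A x| < \<kappa>_min \<rho>\<close>.

  For a unit vector \<open>v\<close>, \<open>A\<^sup>T v\<close> is a standard Gaussian vector \<open>g\<close>, and \<open>|P_C g|\<close> concentrates around its
  mean \<open>\<mu>\<close>. As \<open>r\<close> is sublinear, upper and lower bounds on a \<open>1/6\<close>-net of the sphere, which has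
  at most \<open>13^m\<close> points, give \<open>\<rho> = \<mu>/5\<close>. Finally \<open>|g|\<^sup>2 = |P_C g|\<^sup>2 + dist(g, C)\<^sup>2\<close> and bounded variances
  show \<open>\<mu>\<^sup>2 \<ge> n - D(C)\<^sup>2 - O(1)\<close>, which is at least about \<open>100 m_low / \<kappa>_min\<^sup>2\<close>, while \<open>|A x|\<^sup>2\<close> is of order \<open>m\<close>.
\<close>

section \<open>The standard Gaussian measure\<close>

definition gaussian_density :: "'a::euclidean_space \<Rightarrow> real" where
  "gaussian_density x = (\<Prod>b\<in>Basis. std_normal_density (x \<bullet> b))"

text \<open>A density against \<open>lborel\<close> on an arbitrary Euclidean space covers both
  \<open>real ^ 'n\<close> and \<open>real ^ 'm\<close> and makes translations and rotations
  accessible. \<open>distr_PiM_gaussian\<close> links it to the product measure behind the Gaussian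
  distance.\<close>

definition gaussian :: "'a::euclidean_space measure" where
  "gaussian = density lborel (\<lambda>x. ennreal (gaussian_density x))"

lemma gaussian_density_nonneg [simp]: "0 \<le> gaussian_density x"
  by (simp add: gaussian_density_def prod_nonneg)

lemma norm_square_eq_sum_Basis: "(norm x)\<^sup>2 = (\<Sum>b\<in>Basis. (x \<bullet> b)\<^sup>2)"
  by (subst power2_norm_eq_inner, subst euclidean_inner) (simp add: power2_eq_square)

lemma gaussian_density_eq:
  "gaussian_density (x::'a::euclidean_space) =
    (1 / sqrt (2 * pi)) ^ DIM('a) * exp (- (norm x)\<^sup>2 / 2)"
proof -
  have "gaussian_density x = (\<Prod>b\<in>Basis. 1 / sqrt (2 * pi) * exp (- (x \<bullet> b)\<^sup>2 / 2))"
    by (simp add: gaussian_density_def std_normal_density_def)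
  also have "\<dots> = (1 / sqrt (2 * pi)) ^ DIM('a) * (\<Prod>b\<in>Basis. exp (- (x \<bullet> b)\<^sup>2 / 2))"
    by (simp only: prod.distrib prod_constant)
  also have "(\<Prod>b\<in>Basis. exp (- (x \<bullet> b)\<^sup>2 / 2)) = exp (\<Sum>b\<in>Basis. - (x \<bullet> b)\<^sup>2 / 2)"
    by (simp add: exp_sum)
  also have "(\<Sum>b\<in>Basis. - (x \<bullet> b)\<^sup>2 / 2) = - (norm x)\<^sup>2 / 2"
    by (subst norm_square_eq_sum_Basis) (simp add: sum_negf sum_divide_distrib)
  finally show ?thesis .
qed

lemma gaussian_density_measurable [measurable]: "gaussian_density \<in> borel_measurable borel"
  unfolding gaussian_density_def by measurable

lemma sets_gaussian [simp, measurable_cong]: "sets gaussian = sets borel"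
  by (simp add: gaussian_def)

lemma space_gaussian [simp]: "space gaussian = UNIV"
  by (simp add: gaussian_def)

lemma nn_integral_gaussian:
  "f \<in> borel_measurable borel \<Longrightarrow>
    (\<integral>\<^sup>+x. f x \<partial>gaussian) = (\<integral>\<^sup>+x. ennreal (gaussian_density x) * f x \<partial>lborel)"
  unfolding gaussian_def by (subst nn_integral_density) auto

lemma nn_integral_gaussian_prod:
  fixes f :: "'a::euclidean_space \<Rightarrow> real \<Rightarrow> ennreal"
  assumes [measurable]: "\<And>b. b \<in> Basis \<Longrightarrow> f b \<in> borel_measurable borel"
  shows "(\<integral>\<^sup>+x. (\<Prod>b\<in>Basis. f b (x \<bullet> b)) \<partial>gaussian) =
    (\<Prod>b\<in>Basis. \<integral>\<^sup>+x. ennreal (std_normal_density x) * f b x \<partial>lborel)"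
proof -
  have "(\<integral>\<^sup>+x. (\<Prod>b\<in>Basis. f b (x \<bullet> b)) \<partial>gaussian) =
    (\<integral>\<^sup>+x. (\<Prod>b\<in>Basis. ennreal (std_normal_density (x \<bullet> b)) * f b (x \<bullet> b)) \<partial>lborel)"
    by (subst nn_integral_gaussian)
      (auto simp: gaussian_density_def prod.distrib prod_ennreal)
  also have "\<dots> = (\<Prod>b\<in>Basis. \<integral>\<^sup>+x. ennreal (std_normal_density x) * f b x \<partial>lborel)"
    by (rule nn_integral_lborel_prod) auto
  finally show ?thesis .
qed

lemma nn_integral_std_normal_density: "(\<integral>\<^sup>+x. ennreal (std_normal_density x) \<partial>lborel) = 1"
  by (simp add: nn_integral_eq_integral)

lemma prob_space_gaussian: "prob_space (gaussian :: 'a::euclidean_space measure)"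
proof
  have "emeasure (gaussian :: 'a measure) (space gaussian) =
      (\<integral>\<^sup>+x. (\<Prod>b\<in>Basis. (\<lambda>_ _. 1) b (x \<bullet> b)) \<partial>(gaussian :: 'a measure))"
    by simp
  also have "\<dots> = 1"
    by (subst nn_integral_gaussian_prod) (simp_all add: nn_integral_std_normal_density)
  finally show "emeasure (gaussian :: 'a measure) (space gaussian) = 1" .
qed

interpretation gaussian: prob_space gaussian
  by (rule prob_space_gaussian)

lemma measurable_vec_lambda_PiM:
  "(\<lambda>g. (\<chi> i. g i) :: real ^ 'n::finite) \<in> measurable (\<Pi>\<^sub>M i\<in>UNIV. borel) borel"
proof -
  have "(\<lambda>g. (\<Sum>i\<in>(UNIV::'n set). g i *\<^sub>R axis i 1) :: real^'n) = (\<lambda>g. \<chi> i. g i)"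
    by (rule ext) (simp add: vec_eq_iff axis_def if_distrib cong: if_cong)
  moreover have "(\<lambda>g. (\<Sum>i\<in>(UNIV::'n set). g i *\<^sub>R axis i 1) :: real^'n) \<in>
      measurable (\<Pi>\<^sub>M i\<in>UNIV. borel) borel"
    by measurable
  ultimately show ?thesis by simp
qed

text \<open>Measures on a product are determined by boxes, so it is easier to show first that the
  coordinates of a \<open>gaussian\<close> vector have the product law, and then to push that
  identity back to vectors.\<close>

lemma distr_PiM_gaussian:
  shows "(\<lambda>g. (\<chi> i. g i) :: real ^ 'n::finite) \<in>
      measurable (\<Pi>\<^sub>M i\<in>UNIV. density lborel std_normal_density) borel"
    and "distr (\<Pi>\<^sub>M i\<in>UNIV. density lborel std_normal_density) borel (\<lambda>g. \<chi> i. g i) =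
      (gaussian :: (real ^ 'n) measure)"
proof -
  let ?D = "density lborel (\<lambda>x. ennreal (std_normal_density x))"
  let ?P = "\<Pi>\<^sub>M i\<in>(UNIV :: 'n set). ?D"
  have borelP: "sets ?P = sets (\<Pi>\<^sub>M i\<in>(UNIV :: 'n set). borel)"
    by (rule sets_PiM_cong) auto
  interpret D: prob_space ?D
    by (rule prob_space_normal_density) simp
  interpret product_sigma_finite "\<lambda>i::'n. ?D" ..
  have vec: "(\<lambda>x::real^'n. \<lambda>i. x $ i) \<in> measurable borel ?P"
    unfolding measurable_cong_sets[OF refl borelP]
    by (rule measurable_PiM_single') auto
  show lam: "(\<lambda>g. (\<chi> i. g i) :: real^'n) \<in> measurable ?P borel"
    unfolding measurable_cong_sets[OF borelP refl] by (rule measurable_vec_lambda_PiM)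
  have "distr (gaussian :: (real^'n) measure) ?P (\<lambda>x. \<lambda>i. x $ i) = ?P"
  proof (rule PiM_eqI)
    fix A :: "'n \<Rightarrow> real set"
    assume A: "\<And>i. i \<in> UNIV \<Longrightarrow> A i \<in> sets ?D"
    then have [measurable]: "A i \<in> sets borel" for i by simp
    \<comment> \<open>Boxes are indexed by coordinates, but \<open>nn_integral_gaussian_prod\<close>
      runs over \<open>Basis\<close>; \<open>B\<close> transfers the index through the bijection of
      coordinates with axis vectors.\<close>
    define B where "B b = A (THE i. b = axis i (1::real))" for b :: "real^'n"
    have B: "B (axis i 1) = A i" for i
      by (simp add: B_def axis_eq_axis)
    then have [measurable]: "B b \<in> sets borel" if "b \<in> Basis" for b
      using that by (auto simp: Basis_vec_def)
    have Bas: "(Basis :: (real^'n) set) = (\<lambda>i. axis i 1) ` UNIV"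
      by (auto simp: Basis_vec_def)
    have inj: "inj (\<lambda>i::'n. axis i (1::real))"
      by (auto simp: inj_on_def axis_eq_axis)
    have "Pi\<^sub>E UNIV A \<in> sets ?P"
      using A by (intro sets_PiM_I_finite) simp_all
    moreover have "(\<lambda>x::real^'n. \<lambda>i. x $ i) \<in> measurable gaussian ?P"
      using vec by (simp add: measurable_cong_sets[OF sets_gaussian refl])
    moreover have "(\<lambda>x::real^'n. \<lambda>i. x $ i) -` Pi\<^sub>E UNIV A = {x. \<forall>i. x $ i \<in> A i}"
      by (auto simp: PiE_def Pi_def)
    ultimately have "emeasure (distr gaussian ?P (\<lambda>x. \<lambda>i. x $ i)) (Pi\<^sub>E UNIV A) =
        emeasure gaussian {x::real^'n. \<forall>i. x $ i \<in> A i}"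
      by (simp add: emeasure_distr)
    also have "\<dots> = (\<integral>\<^sup>+x. indicator {x::real^'n. \<forall>i. x $ i \<in> A i} x \<partial>gaussian)"
      by (subst nn_integral_indicator) simp_all
    also have "\<dots> = (\<integral>\<^sup>+x. (\<Prod>b\<in>Basis. indicator (B b) (x \<bullet> b)) \<partial>(gaussian::(real^'n) measure))"
    proof (rule nn_integral_cong)
      fix x :: "real^'n"
      show "indicator {x. \<forall>i. x $ i \<in> A i} x = (\<Prod>b\<in>Basis. indicator (B b) (x \<bullet> b) :: ennreal)"
        unfolding Bas prod.reindex[OF inj]
        by (auto simp: B inner_axis indicator_def)
    qed
    also have "\<dots> = (\<Prod>b\<in>Basis. \<integral>\<^sup>+x. ennreal (std_normal_density x) * indicator (B b) x \<partial>lborel)"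
      by (rule nn_integral_gaussian_prod) auto
    also have "\<dots> = (\<Prod>i\<in>UNIV. \<integral>\<^sup>+x. ennreal (std_normal_density x) * indicator (A i) x \<partial>lborel)"
      unfolding Bas prod.reindex[OF inj] by (simp add: B)
    also have "\<dots> = (\<Prod>i\<in>UNIV. emeasure ?D (A i))"
      by (intro prod.cong refl) (subst emeasure_density; simp)
    finally show "emeasure (distr gaussian ?P (\<lambda>x. \<lambda>i. x $ i)) (Pi\<^sub>E UNIV A) =
      (\<Prod>i\<in>UNIV. emeasure ?D (A i))" .
  qed auto
  then have "distr ?P borel (\<lambda>g. (\<chi> i. g i) :: real^'n) =
      distr (distr (gaussian :: (real^'n) measure) ?P (\<lambda>x. \<lambda>i. x $ i)) borel (\<lambda>g. \<chi> i. g i)"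
    by simp
  also have "\<dots> = distr gaussian borel (\<lambda>x. x)"
  proof (subst distr_distr)
    show "(\<lambda>x::real^'n. \<lambda>i. x $ i) \<in> measurable gaussian ?P"
      using vec by (simp add: measurable_cong_sets[OF sets_gaussian refl])
  qed (use lam in \<open>simp_all add: o_def\<close>)
  also have "\<dots> = gaussian"
    by (rule distr_id2) simp
  finally show "distr ?P borel (\<lambda>g. \<chi> i. g i) = (gaussian :: (real ^ 'n) measure)" .
qed

section \<open>Moments of the standard Gaussian\<close>

text \<open>This finite moment is the majorant for all later exponentials: it dominates
  \<open>exp (l * F x)\<close>, absorbs the discretisation error in
  \<open>exp_difference_le\<close>, and gives the tail of the norm.\<close>

lemma nn_integral_exp_quarter_gaussian:
  "(\<integral>\<^sup>+x. ennreal (exp ((norm x)\<^sup>2 / 4)) \<partial>(gaussian :: 'a::euclidean_space measure)) =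
     ennreal (sqrt 2 ^ DIM('a))"
proof -
  have 1: "ennreal (exp ((norm x)\<^sup>2 / 4)) = (\<Prod>b\<in>Basis. ennreal (exp ((x \<bullet> b)\<^sup>2 / 4)))" for x :: 'a
    by (subst norm_square_eq_sum_Basis) (simp add: sum_divide_distrib exp_sum prod_ennreal)
  \<comment> \<open>The factor \<open>exp (x^2 / 4)\<close> halves the exponent of the density,
    which leaves an unnormalised normal density of variance 2.\<close>
  have 2: "std_normal_density x * exp (x\<^sup>2 / 4) = sqrt 2 * normal_density 0 (sqrt 2) x" for x
    by (simp add: normal_density_def real_sqrt_mult field_simps flip: exp_add)
  have 3: "(\<integral>\<^sup>+x. ennreal (std_normal_density x) * ennreal (exp (x\<^sup>2 / 4)) \<partial>lborel) =
      ennreal (sqrt 2)"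
    by (simp only: ennreal_mult''[symmetric] exp_ge_zero 2)
      (simp add: ennreal_mult' nn_integral_cmult nn_integral_eq_integral)
  show ?thesis
    unfolding 1 by (subst nn_integral_gaussian_prod) (simp_all add: 3 ennreal_power)
qed

lemma nn_integral_norm_square_gaussian:
  "(\<integral>\<^sup>+x. ennreal ((norm x)\<^sup>2) \<partial>(gaussian :: 'a::euclidean_space measure)) = ennreal (real DIM('a))"
proof -
  have 1: "(\<integral>\<^sup>+x. ennreal ((x \<bullet> b)\<^sup>2) \<partial>gaussian) = 1" if b: "b \<in> Basis" for b :: 'a
  proof -
    \<comment> \<open>Factors equal to 1 off \<open>b\<close> isolate one coordinate; the remaining
      ones integrate to total mass 1.\<close>
    let ?f = "\<lambda>c t. if c = b then ennreal (t\<^sup>2) else 1"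
    have "(\<integral>\<^sup>+x. ennreal ((x \<bullet> b)\<^sup>2) \<partial>gaussian) = (\<integral>\<^sup>+x. (\<Prod>c\<in>Basis. ?f c (x \<bullet> c)) \<partial>gaussian)"
      using b by (simp add: prod.delta)
    also have "\<dots> = (\<Prod>c\<in>Basis. \<integral>\<^sup>+t. ennreal (std_normal_density t) * ?f c t \<partial>lborel)"
      by (rule nn_integral_gaussian_prod) simp
    also have "\<dots> = 1"
    proof (rule prod.neutral, rule ballI)
      fix c :: 'a
      have "(\<integral>\<^sup>+t. ennreal (std_normal_density t) * ennreal (t\<^sup>2) \<partial>lborel) =
          (\<integral>\<^sup>+t. ennreal (std_normal_density t * t ^ (2 * 1)) \<partial>lborel)"
        by (simp add: ennreal_mult')
      also have "\<dots> = 1"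
        using has_bochner_integral_integrable std_normal_moment_even[of 1]
        by (subst nn_integral_eq_integral)
          (auto simp: has_bochner_integral_iff fact_numeral)
      finally show "(\<integral>\<^sup>+t. ennreal (std_normal_density t) * ?f c t \<partial>lborel) = 1"
        using nn_integral_std_normal_density by (cases "c = b") (simp_all only: refl if_True if_False mult_1_right)
    qed
    finally show ?thesis .
  qed
  have "(\<integral>\<^sup>+x. ennreal ((norm x)\<^sup>2) \<partial>(gaussian :: 'a measure)) =
      (\<integral>\<^sup>+x. (\<Sum>b\<in>Basis. ennreal ((x \<bullet> b)\<^sup>2)) \<partial>(gaussian :: 'a measure))"
    by (intro nn_integral_cong, subst norm_square_eq_sum_Basis) (simp add: sum_ennreal)
  also have "\<dots> = (\<Sum>b\<in>(Basis::'a set). 1)"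
    by (subst nn_integral_sum) (simp_all add: 1)
  finally show ?thesis by (simp add: ennreal_of_nat_eq_real_of_nat)
qed

section \<open>Translations, shears and rotations\<close>

lemma nn_integral_lborel_translate:
  fixes f :: "'a::euclidean_space \<Rightarrow> ennreal"
  assumes "f \<in> borel_measurable borel"
  shows "(\<integral>\<^sup>+x. f (x + c) \<partial>lborel) = (\<integral>\<^sup>+x. f x \<partial>lborel)"
proof -
  have "(\<integral>\<^sup>+x. f x \<partial>lborel) = (\<integral>\<^sup>+x. f x \<partial>distr lborel borel ((+) c))"
    by (simp add: lborel_distr_plus)
  then show ?thesis
    using assms by (simp add: nn_integral_distr add.commute)
qed

text \<open>Completing the square turns the exponentially tilted density into a multiple of the
  density translated by \<open>w\<close>, whose total mass is 1.\<close>

lemma nn_integral_exp_inner_gaussian: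
  fixes w :: "'a::euclidean_space"
  shows "(\<integral>\<^sup>+x. ennreal (exp (w \<bullet> x)) \<partial>gaussian) = ennreal (exp ((norm w)\<^sup>2 / 2))"
proof -
  have *: "gaussian_density x * exp (w \<bullet> x) = exp ((norm w)\<^sup>2 / 2) * gaussian_density (x + - w)" for x
    unfolding gaussian_density_eq
    by (simp add: power2_norm_eq_inner inner_diff inner_commute field_simps flip: exp_add)
  have "(\<integral>\<^sup>+x. ennreal (exp (w \<bullet> x)) \<partial>gaussian) =
      (\<integral>\<^sup>+x. ennreal (exp ((norm w)\<^sup>2 / 2)) * ennreal (gaussian_density (x + - w)) \<partial>lborel)"
    by (subst nn_integral_gaussian) (simp_all add: * flip: ennreal_mult')
  also have "\<dots> = ennreal (exp ((norm w)\<^sup>2 / 2)) * (\<integral>\<^sup>+x. ennreal (gaussian_density (x + - w)) \<partial>lborel)"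
    by (subst nn_integral_cmult) simp_all
  also have "(\<integral>\<^sup>+x. ennreal (gaussian_density (x + - w)) \<partial>lborel) = (\<integral>\<^sup>+x. 1 \<partial>(gaussian :: 'a measure))"
    by (subst nn_integral_lborel_translate, simp, subst nn_integral_gaussian) simp_all
  finally show ?thesis by (simp add: gaussian.emeasure_space_1[simplified])
qed

text \<open>A shear translates one variable by an amount fixed by the other. Once the moving
  variable is the inner one, translation invariance applies; the first identity needs Fubini to
  arrange that.\<close>

lemma nn_integral_lborel_shear:
  fixes f :: "'a::euclidean_space \<times> 'a \<Rightarrow> ennreal"
  assumes [measurable]: "f \<in> borel_measurable borel"
  shows "(\<integral>\<^sup>+x. \<integral>\<^sup>+y. f (x + a *\<^sub>R y, y) \<partial>lborel \<partial>lborel) = (\<integral>\<^sup>+x. \<integral>\<^sup>+y. f (x, y) \<partial>lborel \<partial>lborel)"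
    and "(\<integral>\<^sup>+x. \<integral>\<^sup>+y. f (x, y + a *\<^sub>R x) \<partial>lborel \<partial>lborel) = (\<integral>\<^sup>+x. \<integral>\<^sup>+y. f (x, y) \<partial>lborel \<partial>lborel)"
proof -
  have [measurable]: "f \<in> borel_measurable (borel \<Otimes>\<^sub>M borel)"
    by (simp add: borel_prod)
  have "(\<integral>\<^sup>+x. \<integral>\<^sup>+y. f (x + a *\<^sub>R y, y) \<partial>lborel \<partial>lborel) = (\<integral>\<^sup>+y. \<integral>\<^sup>+x. f (x + a *\<^sub>R y, y) \<partial>lborel \<partial>lborel)"
    by (rule lborel_pair.Fubini') measurable
  also have "\<dots> = (\<integral>\<^sup>+y. \<integral>\<^sup>+x. f (x, y) \<partial>lborel \<partial>lborel)"
    by (rule nn_integral_cong, rule nn_integral_lborel_translate) measurable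
  also have "\<dots> = (\<integral>\<^sup>+x. \<integral>\<^sup>+y. f (x, y) \<partial>lborel \<partial>lborel)"
    by (rule lborel_pair.Fubini'[symmetric]) measurable
  finally show "(\<integral>\<^sup>+x. \<integral>\<^sup>+y. f (x + a *\<^sub>R y, y) \<partial>lborel \<partial>lborel) = (\<integral>\<^sup>+x. \<integral>\<^sup>+y. f (x, y) \<partial>lborel \<partial>lborel)" .
  show "(\<integral>\<^sup>+x. \<integral>\<^sup>+y. f (x, y + a *\<^sub>R x) \<partial>lborel \<partial>lborel) = (\<integral>\<^sup>+x. \<integral>\<^sup>+y. f (x, y) \<partial>lborel \<partial>lborel)"
    by (rule nn_integral_cong, rule nn_integral_lborel_translate) measurable
qed

section \<open>Gaussian concentration\<close>

lemma nn_integral_gaussian_pair: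
  fixes f :: "'a::euclidean_space \<times> 'a \<Rightarrow> ennreal"
  assumes [measurable]: "f \<in> borel_measurable borel"
  shows "(\<integral>\<^sup>+x. \<integral>\<^sup>+y. f (x, y) \<partial>gaussian \<partial>gaussian) =
    (\<integral>\<^sup>+x. \<integral>\<^sup>+y. ennreal (gaussian_density x * gaussian_density y) * f (x, y) \<partial>lborel \<partial>lborel)"
proof -
  have [measurable]: "f \<in> borel_measurable (borel \<Otimes>\<^sub>M borel)"
    by (simp add: borel_prod)
  have "(\<integral>\<^sup>+x. \<integral>\<^sup>+y. f (x, y) \<partial>gaussian \<partial>gaussian) =
      (\<integral>\<^sup>+x. ennreal (gaussian_density x) * (\<integral>\<^sup>+y. f (x, y) \<partial>gaussian) \<partial>lborel)"
    by (rule nn_integral_gaussian) measurable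
  also have "\<dots> = (\<integral>\<^sup>+x. ennreal (gaussian_density x) *
      (\<integral>\<^sup>+y. ennreal (gaussian_density y) * f (x, y) \<partial>lborel) \<partial>lborel)"
    by (subst nn_integral_gaussian) simp_all
  also have "\<dots> = (\<integral>\<^sup>+x. \<integral>\<^sup>+y. ennreal (gaussian_density x) *
      (ennreal (gaussian_density y) * f (x, y)) \<partial>lborel \<partial>lborel)"
    by (subst nn_integral_cmult) simp_all
  finally show ?thesis by (simp add: ennreal_mult mult.assoc)
qed

text \<open>A rotation is a composition of three shears.\<close>

lemma nn_integral_gaussian_rotate:
  fixes f :: "'a::euclidean_space \<times> 'a \<Rightarrow> ennreal" and c s :: real
  assumes [measurable]: "f \<in> borel_measurable borel" and cs: "c\<^sup>2 + s\<^sup>2 = 1" and c: "c \<noteq> -1"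
  shows "(\<integral>\<^sup>+x. \<integral>\<^sup>+y. f (c *\<^sub>R x + s *\<^sub>R y, - s *\<^sub>R x + c *\<^sub>R y) \<partial>gaussian \<partial>gaussian) =
    (\<integral>\<^sup>+x. \<integral>\<^sup>+y. f (x, y) \<partial>gaussian \<partial>gaussian)"
proof -
  \<comment> \<open>\<open>t\<close> is the tangent of half the angle. The rotation is the shear by
    \<open>t\<close> in the first variable, then by \<open>- s\<close> in the second, then by
    \<open>t\<close> in the first again; \<open>c \<noteq> -1\<close> keeps the denominator
    nonzero.\<close>
  define t where "t = s / (1 + c)"
  have "1 + c \<noteq> 0" using c by auto
  moreover have "s * s = (1 - c) * (1 + c)"
    using cs by (simp add: power2_eq_square algebra_simps)
  ultimately have st: "s * t = 1 - c" and tc: "t * (1 + c) = s"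
    by (simp_all add: t_def)
  \<comment> \<open>Since the product of the two densities is rotation invariant, it can be absorbed
    into the integrand, which leaves a statement about \<open>lborel\<close> alone.\<close>
  define g where "g = (\<lambda>(x, y). ennreal (gaussian_density x * gaussian_density y) * f (x, y))"
  have [measurable]: "f \<in> borel_measurable (borel \<Otimes>\<^sub>M borel)"
    by (simp add: borel_prod)
  have g [measurable]: "g \<in> borel_measurable borel"
    unfolding g_def borel_prod[symmetric] by measurable
  have g': "(\<lambda>(x, y). g (x + t *\<^sub>R y, y)) \<in> borel_measurable borel"
    using g unfolding borel_prod[symmetric] by measurable
  have g'': "(\<lambda>(x, y). g (x + t *\<^sub>R (y - s *\<^sub>R x), y - s *\<^sub>R x)) \<in> borel_measurable borel"
    using g unfolding borel_prod[symmetric] by measurable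
  have rot: "(\<lambda>(x, y). f (c *\<^sub>R x + s *\<^sub>R y, - s *\<^sub>R x + c *\<^sub>R y)) \<in> borel_measurable borel"
    unfolding borel_prod[symmetric] by measurable
  have norm_rot: "(norm (c *\<^sub>R x + s *\<^sub>R y))\<^sup>2 + (norm (- s *\<^sub>R x + c *\<^sub>R y))\<^sup>2 = (norm x)\<^sup>2 + (norm y)\<^sup>2"
    for x y :: 'a
  proof -
    have "(norm (c *\<^sub>R x + s *\<^sub>R y))\<^sup>2 + (norm (- s *\<^sub>R x + c *\<^sub>R y))\<^sup>2 =
        (c\<^sup>2 + s\<^sup>2) * ((norm x)\<^sup>2 + (norm y)\<^sup>2)"
      unfolding power2_norm_eq_inner
      by (simp add: inner_add inner_commute power2_eq_square algebra_simps)
    then show ?thesis by (simp add: cs)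
  qed
  have dens: "gaussian_density (c *\<^sub>R x + s *\<^sub>R y) * gaussian_density (- s *\<^sub>R x + c *\<^sub>R y) =
      gaussian_density x * gaussian_density y" for x y :: 'a
  proof -
    have "exp (- (norm (c *\<^sub>R x + s *\<^sub>R y))\<^sup>2 / 2) * exp (- (norm (- s *\<^sub>R x + c *\<^sub>R y))\<^sup>2 / 2) =
        exp (- (norm x)\<^sup>2 / 2) * exp (- (norm y)\<^sup>2 / 2)"
      unfolding exp_add[symmetric] using norm_rot[of x y] by (simp add: field_simps)
    then show ?thesis
      unfolding gaussian_density_eq by (simp add: algebra_simps)
  qed
  have "(\<integral>\<^sup>+x. \<integral>\<^sup>+y. f (c *\<^sub>R x + s *\<^sub>R y, - s *\<^sub>R x + c *\<^sub>R y) \<partial>gaussian \<partial>gaussian) =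
      (\<integral>\<^sup>+x. \<integral>\<^sup>+y. (\<lambda>(x, y). f (c *\<^sub>R x + s *\<^sub>R y, - s *\<^sub>R x + c *\<^sub>R y)) (x, y) \<partial>gaussian \<partial>gaussian)"
    by simp
  also have "\<dots> = (\<integral>\<^sup>+x. \<integral>\<^sup>+y. g (c *\<^sub>R x + s *\<^sub>R y, - s *\<^sub>R x + c *\<^sub>R y) \<partial>lborel \<partial>lborel)"
    using rot dens by (subst nn_integral_gaussian_pair) (simp_all add: g_def)
  also have "\<dots> = (\<integral>\<^sup>+x. \<integral>\<^sup>+y. (\<lambda>(x, y). g (x + t *\<^sub>R (y - s *\<^sub>R x), y - s *\<^sub>R x))
      (x + t *\<^sub>R y, y) \<partial>lborel \<partial>lborel)"
  proof -
    have 1: "- s *\<^sub>R x + c *\<^sub>R y = y - s *\<^sub>R (x + t *\<^sub>R y)" for x y :: 'a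
    proof -
      have "y - s *\<^sub>R (x + t *\<^sub>R y) = - s *\<^sub>R x + (1 - s * t) *\<^sub>R y"
        by (simp add: algebra_simps)
      then show ?thesis by (simp add: st)
    qed
    have 2: "c *\<^sub>R x + s *\<^sub>R y = (x + t *\<^sub>R y) + t *\<^sub>R (- s *\<^sub>R x + c *\<^sub>R y)" for x y :: 'a
    proof -
      have "(x + t *\<^sub>R y) + t *\<^sub>R (- s *\<^sub>R x + c *\<^sub>R y) = (1 - s * t) *\<^sub>R x + (t * (1 + c)) *\<^sub>R y"
        by (simp add: algebra_simps)
      then show ?thesis by (simp add: st tc)
    qed
    show ?thesis unfolding 2 unfolding 1 by simp
  qed
  also have "\<dots> = (\<integral>\<^sup>+x. \<integral>\<^sup>+y. g (x + t *\<^sub>R (y - s *\<^sub>R x), y - s *\<^sub>R x) \<partial>lborel \<partial>lborel)"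
    using nn_integral_lborel_shear(1)[OF g'', of t] by simp
  also have "\<dots> = (\<integral>\<^sup>+x. \<integral>\<^sup>+y. g (x + t *\<^sub>R y, y) \<partial>lborel \<partial>lborel)"
    using nn_integral_lborel_shear(2)[OF g', of "- s"] by simp
  also have "\<dots> = (\<integral>\<^sup>+x. \<integral>\<^sup>+y. g (x, y) \<partial>lborel \<partial>lborel)"
    by (rule nn_integral_lborel_shear(1)[OF g])
  also have "\<dots> = (\<integral>\<^sup>+x. \<integral>\<^sup>+y. f (x, y) \<partial>gaussian \<partial>gaussian)"
    by (subst nn_integral_gaussian_pair) (simp_all add: g_def)
  finally show ?thesis .
qed

section \<open>Concentration for sublinear functions with bounded subgradients\<close>

text \<open>\<open>s\<close> is a measurable choice of subgradients: together the last two
  conditions give \<open>F x + s x \<bullet> (y - x) \<le> F y\<close>. Hence \<open>F\<close> is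
  sublinear and 1-Lipschitz. The norm of the projection onto a cone and the distance to it are both
  of this kind, so concentration is proved once for the two.\<close>

locale subgradient_selection =
  fixes F :: "'a::euclidean_space \<Rightarrow> real" and s :: "'a \<Rightarrow> 'a"
  assumes s_measurable [measurable]: "s \<in> borel_measurable borel"
    and norm_s_le: "norm (s x) \<le> 1"
    and F_eq: "F x = s x \<bullet> x"
    and F_ge: "s x \<bullet> y \<le> F y"
begin

lemma F_measurable [measurable]: "F \<in> borel_measurable borel"
  unfolding F_eq[abs_def] by measurable

lemma abs_F_le: "\<bar>F x\<bar> \<le> norm x"
proof -
  have "\<bar>s x \<bullet> x\<bar> \<le> norm (s x) * norm x" by (rule Cauchy_Schwarz_ineq2)
  also have "\<dots> \<le> 1 * norm x" by (intro mult_right_mono norm_s_le) simp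
  finally show ?thesis by (simp add: F_eq)
qed

lemma F_add_le: "F (x + y) \<le> F x + F y"
  using F_ge[of "x + y" x] F_ge[of "x + y" y] by (simp add: F_eq[of "x + y"] inner_add_right)

lemma F_scaleR:
  assumes "0 \<le> c"
  shows "F (c *\<^sub>R x) = c * F x"
proof (rule antisym)
  show "F (c *\<^sub>R x) \<le> c * F x"
    using mult_left_mono[OF F_ge[of "c *\<^sub>R x" x] assms] by (simp add: F_eq[of "c *\<^sub>R x"])
  show "c * F x \<le> F (c *\<^sub>R x)"
    using F_ge[of x "c *\<^sub>R x"] by (simp add: F_eq[of x])
qed

text \<open>Here \<open>u\<close> is the end point of a rotation step and \<open>v\<close> the
  direction of motion there, so that the previous point is \<open>c u - d v\<close> with the cosine
  and sine of the step. The bound is linear in \<open>v\<close>, which makes its exponential moment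
  in \<open>v\<close> explicit.\<close>

lemma increment_le:
  fixes c d :: real and u v :: 'a
  shows "F u - F (c *\<^sub>R u - d *\<^sub>R v) \<le> (1 - c) * F u + d * (s u \<bullet> v)"
  using F_ge[of u "c *\<^sub>R u - d *\<^sub>R v"] by (simp add: inner_diff_right F_eq algebra_simps)

text \<open>
  A discrete form of the Maurey-Pisier argument: \<open>x\<close> is carried to \<open>y\<close> along a quarter turn in
  \<open>K\<close> steps, every step being controlled by the subgradient at its end point, which is
  independent of the direction of motion there.
\<close>

lemma exp_difference_le:
  fixes l :: real and K :: nat
  assumes l: "0 \<le> l" and K: "0 < K"
  shows "(\<integral>\<^sup>+x. \<integral>\<^sup>+y. ennreal (exp (l * (F y - F x))) \<partial>gaussian \<partial>gaussian)
     \<le> ennreal (exp (2 * l\<^sup>2) * (1 + exp (4 * l\<^sup>2) * sqrt 2 ^ DIM('a) / K))"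
proof -
  define e where "e = pi / (2 * K)"
  have e0: "0 < e" and Ke: "K * e = pi / 2" using K by (auto simp: e_def field_simps)
  \<comment> \<open>Replacing pi / 2 by 2 is crude but gives round constants: the exponent becomes
    \<open>2 * l^2\<close> instead of \<open>pi^2 / 8 * l^2\<close>.\<close>
  have Ke2: "K * e \<le> 2" using pi_less_4 by (simp add: Ke)
  \<comment> \<open>A step changes the radial part by an amount of order \<open>1 / K^2\<close>, so
    its weight stays of order \<open>1 / K\<close> after the factor \<open>K\<close> coming from
    Jensen.\<close>
  have Kcos: "K * (1 - cos e) \<le> 2 / K"
  proof -
    have "1 - cos e = 2 * (sin (e / 2))\<^sup>2"
      using cos_double_sin[of "e / 2"] by simp
    also have "(sin (e / 2))\<^sup>2 \<le> (e / 2)\<^sup>2"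
      using abs_sin_x_le_abs_x[of "e / 2"] by (simp only: abs_le_square_iff)
    finally have "1 - cos e \<le> e\<^sup>2 / 2" by (simp add: power2_eq_square)
    then have "(K * K) * (1 - cos e) \<le> (K * K) * (e\<^sup>2 / 2)"
      by (intro mult_left_mono) auto
    then have "K * (1 - cos e) * K \<le> (K * e)\<^sup>2 / 2"
      by (simp add: power2_eq_square mult_ac)
    also have "\<dots> \<le> 2\<^sup>2 / 2"
      using Ke2 e0 by (intro divide_right_mono power_mono) auto
    finally show ?thesis using K by (simp add: field_simps)
  qed
  have Ksin: "0 \<le> K * sin e" "K * sin e \<le> 2"
  proof -
    have "e \<le> pi" using K by (auto simp: e_def field_simps intro: order_trans[of _ 1])
    then show "0 \<le> K * sin e" using e0 by (simp add: sin_ge_zero)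
    have "K * sin e \<le> K * e" using e0 by (intro mult_left_mono sin_x_le_x) auto
    with Ke2 show "K * sin e \<le> 2" by simp
  qed
  define a where "a u v = (1 - cos e) * F u + sin e * (s u \<bullet> v)" for u v
  define G where "G k x y = cos (k * e) *\<^sub>R x + sin (k * e) *\<^sub>R y" for k :: nat and x y :: 'a
  define H where "H k x y = - sin (k * e) *\<^sub>R x + cos (k * e) *\<^sub>R y" for k :: nat and x y :: 'a
  have step: "F (G (Suc k) x y) - F (G k x y) \<le> a (G (Suc k) x y) (H (Suc k) x y)" for k x y
  proof -
    have "G k x y = cos e *\<^sub>R G (Suc k) x y - sin e *\<^sub>R H (Suc k) x y"
    proof -
      have "cos e *\<^sub>R G (Suc k) x y - sin e *\<^sub>R H (Suc k) x y =
          cos (Suc k * e - e) *\<^sub>R x + sin (Suc k * e - e) *\<^sub>R y"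
        unfolding G_def H_def cos_diff sin_diff by (simp add: scaleR_add_right scaleR_add_left algebra_simps)
      then show ?thesis by (simp add: G_def algebra_simps)
    qed
    then show ?thesis using increment_le[of "G (Suc k) x y"] by (simp add: a_def)
  qed
  \<comment> \<open>Convexity of \<open>exp\<close> bounds the exponential of the telescoping sum by
    an average of \<open>K\<close> exponentials. Each involves a single rotated pair, and rotation
    invariance then makes all their integrals equal.\<close>
  have ptw: "exp (l * (F y - F x)) \<le> (\<Sum>k<K. 1 / K * exp (l * K * a (G (Suc k) x y) (H (Suc k) x y)))" for x y
  proof -
    have "F y - F x = F (G K x y) - F (G 0 x y)"
      by (simp add: G_def Ke)
    also have "\<dots> = (\<Sum>k<K. F (G (Suc k) x y) - F (G k x y))"
      by (rule sum_lessThan_telescope[symmetric])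
    also have "\<dots> \<le> (\<Sum>k<K. a (G (Suc k) x y) (H (Suc k) x y))"
      by (intro sum_mono step)
    finally have "l * (F y - F x) \<le> l * (\<Sum>k<K. a (G (Suc k) x y) (H (Suc k) x y))"
      using l by (intro mult_left_mono)
    also have "\<dots> = (\<Sum>k<K. (1 / K) *\<^sub>R (l * K * a (G (Suc k) x y) (H (Suc k) x y)))"
      using K by (simp add: sum_distrib_left)
    finally have "exp (l * (F y - F x)) \<le> exp \<dots>" by simp
    also have "\<dots> \<le> (\<Sum>k<K. 1 / K * exp (l * K * a (G (Suc k) x y) (H (Suc k) x y)))"
      using K by (intro convex_on_sum[OF _ _ exp_convex]) auto
    finally show ?thesis .
  qed
  define q where "q = (\<lambda>(u, v). ennreal (exp (l * K * a u v)))"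
  have q [measurable]: "q \<in> borel_measurable borel" "q \<in> borel_measurable (borel \<Otimes>\<^sub>M borel)"
    unfolding q_def a_def borel_prod[symmetric] by measurable
  have dist: "ennreal (a * (1 + b * c)) = ennreal a * (1 + ennreal b * ennreal c)"
    if "0 \<le> a" "0 \<le> b" "0 \<le> c" for a b c :: real
    using that by (simp add: ennreal_mult ennreal_plus)
  define I where "I = (\<integral>\<^sup>+x. \<integral>\<^sup>+y. q (x, y) \<partial>gaussian \<partial>gaussian)"
  have "(\<integral>\<^sup>+x. \<integral>\<^sup>+y. ennreal (exp (l * (F y - F x))) \<partial>gaussian \<partial>gaussian) \<le>
    (\<integral>\<^sup>+x. \<integral>\<^sup>+y. (\<Sum>k<K. ennreal (1 / K) * q (G (Suc k) x y, H (Suc k) x y)) \<partial>gaussian \<partial>gaussian)"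
  proof (intro nn_integral_mono)
    fix x y :: 'a
    have "ennreal (exp (l * (F y - F x))) \<le> ennreal (\<Sum>k<K. 1 / K * exp (l * K * a (G (Suc k) x y) (H (Suc k) x y)))"
      by (intro ennreal_leI ptw)
    then show "ennreal (exp (l * (F y - F x))) \<le> (\<Sum>k<K. ennreal (1 / K) * q (G (Suc k) x y, H (Suc k) x y))"
      by (simp add: q_def flip: ennreal_mult' sum_ennreal)
  qed
  also have "\<dots> = (\<Sum>k<K. ennreal (1 / K) * (\<integral>\<^sup>+x. \<integral>\<^sup>+y. q (G (Suc k) x y, H (Suc k) x y) \<partial>gaussian \<partial>gaussian))"
    by (simp add: nn_integral_sum nn_integral_cmult G_def H_def)
  also have "\<dots> = (\<Sum>k<K. ennreal (1 / K) * I)"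
  proof (rule sum.cong[OF refl])
    fix k assume "k \<in> {..<K}"
    \<comment> \<open>The angle never exceeds a quarter turn, so its cosine is nonnegative and the
      exceptional value -1 of the rotation lemma does not occur.\<close>
    then have "Suc k * e \<le> K * e" using e0 by (intro mult_right_mono) auto
    then have "0 \<le> cos (Suc k * e)" using e0 by (intro cos_ge_zero) (auto simp: Ke intro: order_trans[of _ 0])
    then show "ennreal (1 / K) * (\<integral>\<^sup>+x. \<integral>\<^sup>+y. q (G (Suc k) x y, H (Suc k) x y) \<partial>gaussian \<partial>gaussian) = ennreal (1 / K) * I"
      unfolding G_def H_def I_def
      by (subst nn_integral_gaussian_rotate[OF q(1)]) auto
  qed
  also have "\<dots> = I"
  proof -
    have "of_nat K * ennreal (1 / K) = 1"
      using K by (simp add: ennreal_of_nat_eq_real_of_nat flip: ennreal_mult' ennreal_1)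
    then show ?thesis by (simp add: mult.assoc[symmetric])
  qed
  also have "I \<le> (\<integral>\<^sup>+x. ennreal (exp (2 * l\<^sup>2) * (1 + exp (4 * l\<^sup>2) / K * exp ((norm x)\<^sup>2 / 4))) \<partial>(gaussian :: 'a measure))"
    unfolding I_def
  proof (rule nn_integral_mono)
    fix x :: 'a
    let ?w = "(l * (K * sin e)) *\<^sub>R s x"
    have "(\<integral>\<^sup>+y. q (x, y) \<partial>gaussian) =
        (\<integral>\<^sup>+y. ennreal (exp (l * (K * (1 - cos e)) * F x)) * ennreal (exp (?w \<bullet> y)) \<partial>gaussian)"
      by (intro nn_integral_cong) (simp add: q_def a_def algebra_simps flip: ennreal_mult' exp_add)
    also have "\<dots> = ennreal (exp (l * (K * (1 - cos e)) * F x)) * ennreal (exp ((norm ?w)\<^sup>2 / 2))"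
      by (subst nn_integral_cmult) (simp_all only: nn_integral_exp_inner_gaussian, simp)
    also have "\<dots> = ennreal (exp (l * (K * (1 - cos e)) * F x) * exp ((norm ?w)\<^sup>2 / 2))"
      by (simp add: ennreal_mult')
    also have "\<dots> \<le> ennreal ((1 + exp (4 * l\<^sup>2) / K * exp ((norm x)\<^sup>2 / 4)) * exp (2 * l\<^sup>2))"
    proof (intro ennreal_leI mult_mono)
      have "norm ?w = l * (K * sin e) * norm (s x)"
        using Ksin(1) l by (subst norm_scaleR, subst abs_of_nonneg) simp_all
      also have "\<dots> \<le> (l * 2) * 1"
        using Ksin l norm_s_le[of x] by (intro mult_mono) auto
      finally have "norm ?w \<le> (l * 2) * 1" .
      then have "(norm ?w)\<^sup>2 \<le> (2 * l)\<^sup>2" by (intro power_mono) auto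
      then show "exp ((norm ?w)\<^sup>2 / 2) \<le> exp (2 * l\<^sup>2)" by (simp add: power_mult_distrib)
      have "l * (K * (1 - cos e)) * F x \<le> l * (K * (1 - cos e)) * norm x"
        using l abs_F_le[of x] by (intro mult_left_mono) auto
      also have "\<dots> \<le> l * (2 / K) * norm x"
        by (intro mult_left_mono mult_right_mono Kcos l) simp
      finally have "exp (l * (K * (1 - cos e)) * F x) \<le> exp (l * (2 / K) * norm x)" by simp
      \<comment> \<open>Writing the exponent as a convex combination with 0 moves
        \<open>1 / K\<close> out of the exponential, so that the radial term becomes an additive
        error of order \<open>1 / K\<close>.\<close>
      also have "\<dots> = exp ((1 - 1 / K) *\<^sub>R 0 + (1 / K) *\<^sub>R (2 * l * norm x))"
        by (simp add: field_simps)
      also have "\<dots> \<le> (1 - 1 / K) * exp 0 + (1 / K) * exp (2 * l * norm x)"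
        using K by (intro convex_onD[OF exp_convex, of "1 / K" 0]) auto
      also have "\<dots> \<le> 1 + (1 / K) * exp (4 * l\<^sup>2 + (norm x)\<^sup>2 / 4)"
      proof (intro add_mono mult_left_mono)
        have "0 \<le> (2 * l - norm x / 2)\<^sup>2" by simp
        then show "exp (2 * l * norm x) \<le> exp (4 * l\<^sup>2 + (norm x)\<^sup>2 / 4)"
          by (simp add: power2_eq_square algebra_simps)
      qed auto
      finally show "exp (l * (K * (1 - cos e)) * F x) \<le> 1 + exp (4 * l\<^sup>2) / K * exp ((norm x)\<^sup>2 / 4)"
        by (simp add: exp_add)
    qed (auto intro: add_nonneg_nonneg)
    finally show "(\<integral>\<^sup>+y. q (x, y) \<partial>gaussian) \<le>
        ennreal (exp (2 * l\<^sup>2) * (1 + exp (4 * l\<^sup>2) / K * exp ((norm x)\<^sup>2 / 4)))"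
      by (simp add: mult.commute)
  qed
  also have "\<dots> = (\<integral>\<^sup>+x. ennreal (exp (2 * l\<^sup>2)) * (1 + ennreal (exp (4 * l\<^sup>2) / K) * ennreal (exp ((norm x)\<^sup>2 / 4))) \<partial>(gaussian :: 'a measure))"
    by (intro nn_integral_cong dist) auto
  also have "\<dots> = ennreal (exp (2 * l\<^sup>2)) * (1 + ennreal (exp (4 * l\<^sup>2) / K) * ennreal (sqrt 2 ^ DIM('a)))"
    by (simp add: nn_integral_cmult nn_integral_add nn_integral_exp_quarter_gaussian
        gaussian.emeasure_space_1[simplified])
  also have "\<dots> = ennreal (exp (2 * l\<^sup>2) * (1 + exp (4 * l\<^sup>2) * sqrt 2 ^ DIM('a) / K))"
    by (simp add: dist[symmetric] mult.assoc)
  finally show ?thesis .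
qed

end

lemma integrable_exp_quarter_gaussian:
  "integrable (gaussian :: 'a::euclidean_space measure) (\<lambda>x. exp ((norm x)\<^sup>2 / 4))"
  by (intro integrableI_nonneg) (simp_all add: nn_integral_exp_quarter_gaussian)

lemma integrable_norm_square_gaussian:
  "integrable (gaussian :: 'a::euclidean_space measure) (\<lambda>x. (norm x)\<^sup>2)"
  by (intro integrableI_nonneg) (simp_all add: nn_integral_norm_square_gaussian)

lemma integral_norm_square_gaussian:
  "(\<integral>x. (norm x)\<^sup>2 \<partial>(gaussian :: 'a::euclidean_space measure)) = real DIM('a)"
  by (intro integral_eq_nn_integral[THEN trans]) (simp_all add: nn_integral_norm_square_gaussian)

section \<open>Exponential moments, tails and variance\<close>

context subgradient_selection
begin

abbreviation "mean \<equiv> \<integral>x. F x \<partial>gaussian"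

lemma integrable_exp_F: "integrable gaussian (\<lambda>x. exp (l * F x))"
proof (rule Bochner_Integration.integrable_bound)
  show "integrable gaussian (\<lambda>x::'a. exp (l\<^sup>2) * exp ((norm x)\<^sup>2 / 4))"
    by (intro integrable_mult_right integrable_exp_quarter_gaussian)
  show "AE x in gaussian. norm (exp (l * F x)) \<le> norm (exp (l\<^sup>2) * exp ((norm x)\<^sup>2 / 4))"
  proof (rule AE_I2)
    fix x :: 'a
    have "l * F x \<le> \<bar>l\<bar> * \<bar>F x\<bar>"
      by (metis abs_ge_self abs_mult)
    also have "\<dots> \<le> \<bar>l\<bar> * norm x"
      by (intro mult_left_mono abs_F_le) simp
    also have "\<dots> \<le> l\<^sup>2 + (norm x)\<^sup>2 / 4"
    proof -
      have "0 \<le> (\<bar>l\<bar> - norm x / 2)\<^sup>2" by simp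
      then show ?thesis by (simp add: power2_diff power_divide)
    qed
    finally show "norm (exp (l * F x)) \<le> norm (exp (l\<^sup>2) * exp ((norm x)\<^sup>2 / 4))"
      by (simp flip: exp_add)
  qed
qed simp

lemma integrable_F_square: "integrable gaussian (\<lambda>x. (F x)\<^sup>2)"
proof (rule Bochner_Integration.integrable_bound[OF integrable_norm_square_gaussian])
  show "AE x in gaussian. norm ((F x)\<^sup>2) \<le> norm ((norm x)\<^sup>2)"
    using abs_F_le by (intro AE_I2) (simp add: abs_le_square_iff[symmetric])
qed simp

lemma integrable_F: "integrable gaussian F"
  by (rule gaussian.square_integrable_imp_integrable[OF _ integrable_F_square]) simp

text \<open>The exponential of the difference of two independent copies factorises, and the error
  term of \<open>exp_difference_le\<close> vanishes as \<open>K\<close> tends to infinity.\<close>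

lemma exp_moment_mult_le:
  assumes l: "0 \<le> l"
  shows "(\<integral>x. exp (l * F x) \<partial>gaussian) * (\<integral>x. exp (- l * F x) \<partial>gaussian) \<le> exp (2 * l\<^sup>2)"
proof -
  let ?E = "\<lambda>l. \<integral>x. exp (l * F x) \<partial>gaussian"
  have nn: "(\<integral>\<^sup>+x. ennreal (exp (l * F x)) \<partial>gaussian) = ennreal (?E l)" for l
    by (intro nn_integral_eq_integral integrable_exp_F) simp
  have "(\<integral>\<^sup>+x. \<integral>\<^sup>+y. ennreal (exp (l * (F y - F x))) \<partial>gaussian \<partial>gaussian) =
      (\<integral>\<^sup>+x. \<integral>\<^sup>+y. ennreal (exp (- l * F x)) * ennreal (exp (l * F y)) \<partial>gaussian \<partial>gaussian)"
    by (intro nn_integral_cong) (simp add: algebra_simps flip: ennreal_mult' exp_add)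
  also have "\<dots> = (\<integral>\<^sup>+x. ennreal (exp (- l * F x)) * ennreal (?E l) \<partial>gaussian)"
    by (simp only: nn[symmetric]) (simp add: nn_integral_cmult)
  also have "\<dots> = ennreal (?E (- l)) * ennreal (?E l)"
    by (simp only: nn[symmetric]) (simp add: nn_integral_multc)
  finally have eq: "(\<integral>\<^sup>+x. \<integral>\<^sup>+y. ennreal (exp (l * (F y - F x))) \<partial>gaussian \<partial>gaussian) =
      ennreal (?E l * ?E (- l))"
    by (simp add: ennreal_mult' mult.commute)
  define B where "B = exp (4 * l\<^sup>2) * sqrt 2 ^ DIM('a)"
  have "?E l * ?E (- l) \<le> exp (2 * l\<^sup>2) * (1 + B / Suc K)" for K
    using exp_difference_le[OF l, of "Suc K"]
    by (simp add: eq B_def del: of_nat_Suc)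
  moreover have "(\<lambda>K. exp (2 * l\<^sup>2) * (1 + B / Suc K)) \<longlonglongrightarrow> exp (2 * l\<^sup>2) * (1 + 0)"
    by (intro tendsto_intros LIMSEQ_Suc[OF lim_const_over_n])
  ultimately show ?thesis
    by (intro LIMSEQ_le_const) auto
qed

text \<open>By Jensen, \<open>exp (- l * mean)\<close> is at most the exponential moment of
  \<open>- l * F\<close>, so an independent copy may be replaced by the mean without loss.\<close>

lemma exp_moment_le:
  "(\<integral>x. exp (l * (F x - mean)) \<partial>gaussian) \<le> exp (2 * l\<^sup>2)"
proof -
  let ?E = "\<lambda>l. \<integral>x. exp (l * F x) \<partial>gaussian"
  have "exp (- l * mean) = exp (\<integral>x. - l * F x \<partial>gaussian)"
    by simp
  also have "\<dots> \<le> (\<integral>x. exp (- l * F x) \<partial>gaussian)"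
    by (rule gaussian.jensens_inequality[where I = UNIV])
      (use integrable_exp_F[of "- l"] in \<open>auto intro: integrable_F exp_convex\<close>)
  finally have J: "exp (- l * mean) \<le> ?E (- l)" .
  have "(\<integral>x. exp (l * (F x - mean)) \<partial>gaussian) = (\<integral>x. exp (l * F x) * exp (- l * mean) \<partial>gaussian)"
    by (simp add: algebra_simps flip: exp_add)
  also have "\<dots> = ?E l * exp (- l * mean)"
    by simp
  also have "\<dots> \<le> ?E l * ?E (- l)"
    by (intro mult_left_mono J integral_nonneg) auto
  also have "\<dots> \<le> exp (2 * l\<^sup>2)"
    using exp_moment_mult_le[of l] exp_moment_mult_le[of "- l"]
    by (cases "0 \<le> l") (auto simp: mult.commute)
  finally show ?thesis .
qed

lemma integrable_exp_centered: "integrable gaussian (\<lambda>x. exp (l * (F x - mean)))"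
proof -
  have "integrable gaussian (\<lambda>x. exp (l * F x) * exp (- l * mean))"
    by (intro integrable_mult_left integrable_exp_F)
  then show ?thesis by (simp add: algebra_simps flip: exp_add)
qed

lemma concentration:
  assumes t: "0 < t"
  shows "measure gaussian {x. t \<le> \<bar>F x - mean\<bar>} \<le> 2 * exp (- t\<^sup>2 / 8)"
proof -
  have tail: "measure gaussian {x. t \<le> sg * (F x - mean)} \<le> exp (- t\<^sup>2 / 8)"
    if "\<bar>sg\<bar> = 1" for sg
  proof -
    \<comment> \<open>This value minimises the Chernoff exponent \<open>2 * l^2 - l * t\<close>,
      with minimum \<open>- t^2 / 8\<close>.\<close>
    define l where "l = t / 4"
    have l: "0 < l" using t by (simp add: l_def)
    have "{x. t \<le> sg * (F x - mean)} = {x \<in> space gaussian. exp (l * t) \<le> exp (l * sg * (F x - mean))}"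
      using l by (auto simp: mult.assoc)
    then have "measure gaussian {x. t \<le> sg * (F x - mean)} \<le>
        (\<integral>x. exp (l * sg * (F x - mean)) \<partial>gaussian) / exp (l * t)"
      using integral_Markov_inequality_measure[OF integrable_exp_centered, of "{}" "l * sg" "exp (l * t)"]
      by simp
    also have "\<dots> \<le> exp (2 * (l * sg)\<^sup>2) / exp (l * t)"
      by (intro divide_right_mono exp_moment_le) simp
    also have "\<dots> = exp (- t\<^sup>2 / 8)"
    proof -
      have "(l * sg)\<^sup>2 = l\<^sup>2"
        using that by (metis abs_1 abs_mult mult_1_right power2_abs power_mult_distrib)
      then show ?thesis unfolding l_def by (simp only:) (simp add: power2_eq_square flip: exp_diff)
    qed
    finally show ?thesis .
  qed
  have "measure gaussian {x. t \<le> \<bar>F x - mean\<bar>} \<le>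
      measure gaussian ({x. t \<le> 1 * (F x - mean)} \<union> {x. t \<le> -1 * (F x - mean)})"
    by (intro gaussian.finite_measure_mono) (auto simp: abs_if)
  also have "\<dots> \<le> measure gaussian {x. t \<le> 1 * (F x - mean)} + measure gaussian {x. t \<le> -1 * (F x - mean)}"
    by (intro measure_Un_le) simp_all
  also have "\<dots> \<le> exp (- t\<^sup>2 / 8) + exp (- t\<^sup>2 / 8)"
    by (intro add_mono tail) simp_all
  finally show ?thesis by simp
qed

text \<open>The variance is bounded through the exponential moments at 1 and -1, since
  \<open>z^2\<close> is dominated by a combination of \<open>exp z\<close> and
  \<open>exp (- z)\<close>. The constant comes from \<open>4 * exp 2 - 2 \<le> 28\<close>.\<close>

lemma second_moment_le: "(\<integral>x. (F x)\<^sup>2 \<partial>gaussian) \<le> mean\<^sup>2 + 28"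
proof -
  have sq: "z\<^sup>2 \<le> 2 * (exp (1 * z) + exp ((-1) * z)) - 2" for z :: real
  proof -
    have "1 + \<bar>z\<bar> + \<bar>z\<bar>\<^sup>2 / 2 \<le> exp \<bar>z\<bar>" by (rule exp_lower_Taylor_quadratic) simp
    moreover have "exp \<bar>z\<bar> \<le> exp z + exp (- z)" by (simp add: abs_if)
    ultimately show ?thesis by simp
  qed
  have e2: "exp 2 \<le> (15/2 :: real)"
  proof -
    have "exp 2 = (exp 1)^2" by (simp flip: exp_double)
    also have "\<dots> \<le> (272/100 :: real)^2" using e_less_272 by (intro power_mono) auto
    finally show ?thesis by (simp add: power2_eq_square)
  qed
  have "(\<integral>x. (F x)\<^sup>2 \<partial>gaussian) - mean\<^sup>2 = (\<integral>x. (F x - mean)\<^sup>2 \<partial>gaussian)"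
    using gaussian.variance_eq[OF integrable_F integrable_F_square] by simp
  also have "\<dots> \<le> (\<integral>x. 2 * (exp (1 * (F x - mean)) + exp ((-1) * (F x - mean))) - 2 \<partial>gaussian)"
  proof (rule integral_mono)
    have "integrable gaussian (\<lambda>x. (F x)\<^sup>2 - 2 * mean * F x + mean\<^sup>2)"
      by (intro Bochner_Integration.integrable_add Bochner_Integration.integrable_diff
          integrable_mult_right integrable_F integrable_F_square) simp
    then show "integrable gaussian (\<lambda>x. (F x - mean)\<^sup>2)"
      by (simp add: power2_diff algebra_simps)
    show "integrable gaussian (\<lambda>x. 2 * (exp (1 * (F x - mean)) + exp ((-1) * (F x - mean))) - 2)"
      by (intro Bochner_Integration.integrable_add Bochner_Integration.integrable_diff
          integrable_mult_right integrable_exp_centered) simp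
  qed (rule sq)
  also have "\<dots> = 2 * ((\<integral>x. exp (1 * (F x - mean)) \<partial>gaussian) + (\<integral>x. exp ((-1) * (F x - mean)) \<partial>gaussian)) - 2"
    using integrable_exp_centered[of 1] integrable_exp_centered[of "-1"]
    by (simp add: gaussian.prob_space[simplified] del: mult_minus1)
  also have "\<dots> \<le> 2 * (exp (2 * 1\<^sup>2) + exp (2 * (-1)\<^sup>2)) - 2"
    by (intro diff_right_mono mult_left_mono add_mono exp_moment_le) simp
  also have "\<dots> \<le> 28" using e2 by simp
  finally show ?thesis by simp
qed

end

section \<open>Nets and closed convex cones\<close>

text \<open>Volume comparison: balls of radius \<open>e / 2\<close> around the points are disjoint
  and lie in the ball of radius \<open>1 + e / 2\<close>.\<close>

lemma card_separated_le:
  fixes T :: "'a::euclidean_space set"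
  assumes fin: "finite T" and T: "T \<subseteq> cball 0 1" and e: "0 < e"
    and sep: "\<And>x y. x \<in> T \<Longrightarrow> y \<in> T \<Longrightarrow> x \<noteq> y \<Longrightarrow> e < dist x y"
  shows "card T \<le> (1 + 2 / e) ^ DIM('a)"
proof -
  let ?c = "measure lborel (ball (0::'a) 1)"
  have c: "0 < ?c" by (rule content_ball_pos) simp
  have disj: "disjoint_family_on (\<lambda>x. ball x (e / 2)) T"
    unfolding disjoint_family_on_def
  proof (intro ballI impI, rule ccontr)
    fix x y assume "x \<in> T" "y \<in> T" "x \<noteq> y" "ball x (e / 2) \<inter> ball y (e / 2) \<noteq> {}"
    then obtain z where "dist x z < e / 2" "dist y z < e / 2" by auto
    then have "dist x y < e" using dist_triangle_half_r[of z x e y] by (simp add: dist_commute)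
    with sep[OF \<open>x \<in> T\<close> \<open>y \<in> T\<close> \<open>x \<noteq> y\<close>] show False by simp
  qed
  have "card T * ((e / 2) ^ DIM('a) * ?c) = (\<Sum>x\<in>T. measure lborel (ball x (e / 2)))"
    using e by (simp add: content_ball_conv_unit_ball[of "e / 2"])
  also have "\<dots> = measure lborel (\<Union>x\<in>T. ball x (e / 2))"
  proof (rule measure_finite_Union[symmetric, OF fin _ disj])
    show "emeasure lborel (ball x (e / 2)) \<noteq> \<infinity>" for x :: 'a
      using emeasure_lborel_ball_finite[of x "e / 2"] by (rule less_imp_neq)
  qed auto
  also have "\<dots> \<le> measure lborel (ball (0::'a) (1 + e / 2))"
  proof (rule measure_mono_fmeasurable)
    show "(\<Union>x\<in>T. ball x (e / 2)) \<subseteq> ball 0 (1 + e / 2)"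
    proof
      fix z assume "z \<in> (\<Union>x\<in>T. ball x (e / 2))"
      then obtain x where x: "x \<in> T" "dist x z < e / 2" by auto
      then have "dist 0 z < 1 + e / 2"
        using dist_triangle[of 0 z x] T by (auto simp: subset_iff)
      then show "z \<in> ball 0 (1 + e / 2)" by simp
    qed
  next
    show "(\<Union>x\<in>T. ball x (e / 2)) \<in> sets lborel" by (simp add: open_UN borel_open)
    show "ball (0::'a) (1 + e / 2) \<in> fmeasurable lborel"
      by (intro fmeasurableI emeasure_lborel_ball_finite) simp
  qed
  also have "\<dots> = (1 + e / 2) ^ DIM('a) * ?c"
    using e by (intro content_ball_conv_unit_ball) simp
  finally have "card T * (e / 2) ^ DIM('a) \<le> (1 + e / 2) ^ DIM('a)"
    using c by (simp add: mult.assoc[symmetric])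
  then have "card T \<le> (1 + e / 2) ^ DIM('a) / (e / 2) ^ DIM('a)"
    using e by (simp add: pos_le_divide_eq)
  also have "\<dots> = ((1 + e / 2) / (e / 2)) ^ DIM('a)"
    by (rule power_divide[symmetric])
  also have "(1 + e / 2) / (e / 2) = 1 + 2 / e"
    using e by (simp add: field_simps)
  finally show ?thesis .
qed

text \<open>A separated subset of largest cardinality is a net, because a point far from it could be
  added. The volume bound ensures that a largest one exists.\<close>

lemma sphere_net:
  assumes e: "0 < e"
  obtains T :: "'a::euclidean_space set"
  where "finite T" "T \<subseteq> sphere 0 1" "card T \<le> (1 + 2 / e) ^ DIM('a)"
    and "\<And>v. norm v = 1 \<Longrightarrow> \<exists>w\<in>T. norm (v - w) \<le> e"
proof -
  define sep where "sep T \<longleftrightarrow> finite T \<and> T \<subseteq> sphere (0::'a) 1 \<and>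
    (\<forall>x\<in>T. \<forall>y\<in>T. x \<noteq> y \<longrightarrow> e < dist x y)" for T
  have card_le: "card T \<le> (1 + 2 / e) ^ DIM('a)" if "sep T" for T
    using that e by (intro card_separated_le) (auto simp: sep_def)
  have "\<exists>T. sep T \<and> (\<forall>T'. sep T' \<longrightarrow> card T' \<le> card T)"
  proof (rule Lattices_Big.ex_has_greatest_nat)
    show "sep {}" by (simp add: sep_def)
    show "\<forall>T. sep T \<longrightarrow> card T < Suc (nat \<lfloor>(1 + 2 / e) ^ DIM('a)\<rfloor>)"
      using card_le by (auto simp: le_nat_floor less_Suc_eq_le)
  qed
  then obtain T where T: "sep T" and max: "\<And>T'. sep T' \<Longrightarrow> card T' \<le> card T" by auto
  have "\<exists>w\<in>T. norm (v - w) \<le> e" if v: "norm v = 1" for v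
  proof (rule ccontr)
    assume "\<not> (\<exists>w\<in>T. norm (v - w) \<le> e)"
    then have far: "e < dist v w" if "w \<in> T" for w
      using that by (auto simp: dist_norm not_le)
    then have "v \<notin> T" using e by fastforce
    moreover have "sep (insert v T)"
      using T v far by (auto simp: sep_def dist_commute)
    ultimately show False
      using max[of "insert v T"] T by (simp add: sep_def)
  qed
  with T card_le[OF T] show thesis by (intro that[of T]) (auto simp: sep_def)
qed

text \<open>The supremum \<open>R\<close> of \<open>r\<close> on the sphere, finite thanks to
  \<open>B\<close>, satisfies \<open>R \<le> 3/2 * \<mu> + R / 6\<close>, hence
  \<open>R \<le> 9/5 * \<mu>\<close>. Moving from the net to any unit vector then costs at most
  \<open>R / 6 \<le> 3/10 * \<mu>\<close>, and \<open>1/2 - 3/10 = 1/5\<close>.\<close>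

lemma sublinear_ge_of_net:
  fixes r :: "'a::euclidean_space \<Rightarrow> real"
  assumes add: "\<And>v w. r (v + w) \<le> r v + r w"
    and scale: "\<And>c v. 0 \<le> c \<Longrightarrow> r (c *\<^sub>R v) = c * r v"
    and bound: "\<And>v. r v \<le> B * norm v"
    and net: "\<And>v. norm v = 1 \<Longrightarrow> \<exists>w\<in>T. norm (v - w) \<le> 1 / 6"
    and T: "\<And>w. w \<in> T \<Longrightarrow> \<bar>r w - \<mu>\<bar> \<le> \<mu> / 2"
  shows "\<mu> / 5 * norm v \<le> r v"
proof (cases "v = 0")
  case True
  then show ?thesis using scale[of 0 0] by simp
next
  case False
  define R where "R = (SUP v\<in>sphere 0 1. r v)"
  have bdd: "bdd_above (r ` sphere 0 1)"
  proof (rule bdd_aboveI2)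
    fix x :: 'a assume "x \<in> sphere 0 1"
    then show "r x \<le> B" using bound[of x] by simp
  qed
  have r_R: "r x \<le> R" if "norm x = 1" for x
    unfolding R_def using that by (intro cSUP_upper bdd) simp
  have r0: "r 0 = 0" using scale[of 0 0] by simp
  have r_le: "r x \<le> R * norm x" for x
  proof (cases "x = 0")
    case False
    then have "r x = norm x * r (x /\<^sub>R norm x)"
      using scale[of "norm x" "x /\<^sub>R norm x"] by simp
    also have "\<dots> \<le> norm x * R" using False by (intro mult_left_mono r_R) simp_all
    finally show ?thesis by (simp add: mult.commute)
  qed (simp add: r0)
  obtain b :: 'a where "norm b = 1" using nonempty_Basis norm_Basis by blast
  \<comment> \<open>\<open>r\<close> is not assumed nonnegative; subadditivity at opposite vectors
    still makes its supremum nonnegative, which \<open>r6\<close> relies on.\<close>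
  have "0 \<le> r b + r (- b)" using add[of b "- b"] by (simp add: r0)
  with r_R[of b] r_R[of "- b"] \<open>norm b = 1\<close> have R0: "0 \<le> R" by simp
  have r6: "r x \<le> R / 6" if "norm x \<le> 1 / 6" for x
    using r_le[of x] mult_left_mono[OF that R0] by simp
  have "R \<le> 3 / 2 * \<mu> + R / 6"
    unfolding R_def
  proof (rule cSUP_least)
    show "sphere (0::'a) 1 \<noteq> {}" using \<open>norm b = 1\<close> by auto
    fix x :: 'a assume "x \<in> sphere 0 1"
    then obtain w where w: "w \<in> T" "norm (x - w) \<le> 1 / 6" using net[of x] by auto
    have "r x \<le> r w + r (x - w)" using add[of w "x - w"] by simp
    moreover have "r w \<le> 3 / 2 * \<mu>" using T[OF w(1)] by linarith
    ultimately show "r x \<le> 3 / 2 * \<mu> + (SUP v\<in>sphere 0 1. r v) / 6"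
      unfolding R_def[symmetric] using r6[OF w(2)] by linarith
  qed
  then have R: "R \<le> 9 / 5 * \<mu>" by simp
  let ?x = "v /\<^sub>R norm v"
  have "norm ?x = 1" using False by simp
  from net[OF this] obtain w where w: "w \<in> T" "norm (?x - w) \<le> 1 / 6" by blast
  have "r w \<le> r ?x + r (w - ?x)" using add[of ?x "w - ?x"] by simp
  moreover have "\<mu> / 2 \<le> r w" using T[OF w(1)] by linarith
  moreover have "r (w - ?x) \<le> R / 6" using w(2) by (intro r6) (simp only: norm_minus_commute)
  ultimately have "\<mu> / 5 \<le> r ?x" using R by linarith
  then have "norm v * (\<mu> / 5) \<le> norm v * r ?x" by (intro mult_left_mono) simp_all
  also have "\<dots> = r v" using scale[of "norm v" ?x] False by simp
  finally show ?thesis by (simp add: mult.commute)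
qed

section \<open>Projection onto a closed convex cone\<close>

text \<open>At \<open>v = 0\<close> the normalised vector is 0 because \<open>inverse 0 = 0\<close>,
  hence an inequality. This default lets normalised vectors serve as subgradients
  everywhere.\<close>

lemma norm_normalize_le: "norm (v /\<^sub>R norm v) \<le> 1"
  by (cases "v = 0") simp_all

lemma inner_normalize: "v \<bullet> x = (norm v)\<^sup>2 \<Longrightarrow> (v /\<^sub>R norm v) \<bullet> x = norm v"
  by (cases "v = 0") (simp_all add: power2_eq_square)

locale closed_convex_cone =
  fixes C :: "'a::euclidean_space set"
  assumes closed: "closed C" and convex_cone: "convex_cone C"
begin

abbreviation "P \<equiv> closest_point C"

lemma convex: "convex C"
  using convex_cone by (simp add: convex_cone_def)

lemma mem_scaleR: "x \<in> C \<Longrightarrow> 0 \<le> c \<Longrightarrow> c *\<^sub>R x \<in> C"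
  using convex_cone by (auto simp: convex_cone_def conic_def)

lemma nonempty: "C \<noteq> {}"
  using convex_cone by (simp add: convex_cone_def)

lemma zero_mem: "0 \<in> C"
  using mem_scaleR[of _ 0] nonempty by auto

lemma P_mem: "P x \<in> C"
  using closed nonempty by (rule closest_point_in_set)

text \<open>The variational inequality of the closest point, tested at
  \<open>2 *\<^sub>R P x\<close> and at 0, gives the two signs.\<close>

lemma orthogonal: "(x - P x) \<bullet> P x = 0"
proof (rule antisym)
  show "(x - P x) \<bullet> P x \<le> 0"
    using closest_point_dot[OF convex closed mem_scaleR[OF P_mem], of 2 x x]
    by (simp add: scaleR_2)
  show "0 \<le> (x - P x) \<bullet> P x"
    using closest_point_dot[OF convex closed zero_mem, of x] by simp
qed

text \<open>The residual lies in the polar cone, as in Moreau's decomposition.\<close>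

lemma residual_inner_le: "u \<in> C \<Longrightarrow> (x - P x) \<bullet> u \<le> 0"
  using closest_point_dot[OF convex closed, of u x] orthogonal[of x]
  by (simp add: inner_diff_right)

lemma inner_P: "x \<bullet> P x = (norm (P x))\<^sup>2"
  using orthogonal[of x] by (simp add: inner_diff_left power2_norm_eq_inner)

lemma P_inner: "P x \<bullet> x = (norm (P x))\<^sup>2"
  using inner_P[of x] by (simp only: inner_commute)

lemma infdist_eq: "infdist x C = norm (x - P x)"
proof (rule antisym)
  show "infdist x C \<le> norm (x - P x)"
    using infdist_le[OF P_mem, of x x] by (simp add: dist_norm)
  show "norm (x - P x) \<le> infdist x C"
    unfolding infdist_notempty[OF nonempty]
    using closest_point_le[OF closed, of _ x] by (intro cINF_greatest nonempty) (simp add: dist_norm)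
qed

lemma pythagoras: "(norm (P x))\<^sup>2 + (infdist x C)\<^sup>2 = (norm x)\<^sup>2"
  using inner_P[of x]
  by (simp add: infdist_eq power2_norm_eq_inner inner_diff inner_commute)

lemma P_measurable [measurable]: "P \<in> borel_measurable borel"
  by (intro borel_measurable_continuous_onI continuous_on_closest_point convex closed nonempty)

text \<open>\<open>norm (P x)\<close> is the support function of the part of \<open>C\<close> in the
  unit ball, and the normalised projection attains it. The subgradient inequality follows by
  splitting \<open>y\<close> into \<open>P y\<close> and a residual in the polar cone.\<close>

sublocale proj: subgradient_selection "\<lambda>x. norm (P x)" "\<lambda>x. P x /\<^sub>R norm (P x)"
proof
  fix x y
  show "norm (P x /\<^sub>R norm (P x)) \<le> 1" by (rule norm_normalize_le)
  show "norm (P x) = (P x /\<^sub>R norm (P x)) \<bullet> x"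
    by (rule inner_normalize[symmetric]) (rule P_inner)
  have "(P x /\<^sub>R norm (P x)) \<bullet> y = (y - P y) \<bullet> (P x /\<^sub>R norm (P x)) + (P x /\<^sub>R norm (P x)) \<bullet> P y"
    by (simp add: inner_diff_left inner_diff_right inner_commute algebra_simps)
  also have "\<dots> \<le> 0 + norm (P x /\<^sub>R norm (P x)) * norm (P y)"
    by (intro add_mono residual_inner_le mem_scaleR P_mem norm_cauchy_schwarz) simp
  also have "\<dots> \<le> 1 * norm (P y)"
    by (simp only: add_0) (intro mult_right_mono norm_normalize_le norm_ge_zero)
  finally show "(P x /\<^sub>R norm (P x)) \<bullet> y \<le> norm (P y)" by simp
qed measurable

text \<open>Dual to the projection: the normalised residual of \<open>x\<close> lies in the polar
  cone, so its inner product with \<open>P y\<close> is nonpositive and only the residual of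
  \<open>y\<close> contributes.\<close>

sublocale dist: subgradient_selection "\<lambda>x. infdist x C" "\<lambda>x. (x - P x) /\<^sub>R norm (x - P x)"
proof
  fix x y
  show "norm ((x - P x) /\<^sub>R norm (x - P x)) \<le> 1" by (rule norm_normalize_le)
  show "infdist x C = ((x - P x) /\<^sub>R norm (x - P x)) \<bullet> x"
  proof -
    have "(x - P x) \<bullet> x = (norm (x - P x))\<^sup>2"
      using orthogonal[of x] by (simp add: power2_norm_eq_inner inner_diff_right)
    then show ?thesis unfolding infdist_eq by (rule inner_normalize[symmetric])
  qed
  let ?s = "(x - P x) /\<^sub>R norm (x - P x)"
  have "?s \<bullet> P y \<le> 0"
    using residual_inner_le[OF P_mem, of x y] by (simp add: mult_nonneg_nonpos)
  moreover have "?s \<bullet> (y - P y) \<le> norm ?s * norm (y - P y)"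
    by (rule norm_cauchy_schwarz)
  moreover have "norm ?s * norm (y - P y) \<le> 1 * norm (y - P y)"
    by (intro mult_right_mono norm_normalize_le norm_ge_zero)
  ultimately show "?s \<bullet> y \<le> infdist y C"
    by (simp only: infdist_eq) (simp add: inner_diff_right)
qed measurable

text \<open>Integrate \<open>pythagoras\<close>; each of the two second moments exceeds the squared
  mean by at most 28.\<close>

lemma mean_square_ge:
  "proj.mean\<^sup>2 \<ge> real DIM('a) - dist.mean\<^sup>2 - 56"
proof -
  have "real DIM('a) = (\<integral>x. (norm (P x))\<^sup>2 + (infdist x C)\<^sup>2 \<partial>gaussian)"
    by (simp only: pythagoras integral_norm_square_gaussian)
  also have "\<dots> = (\<integral>x. (norm (P x))\<^sup>2 \<partial>gaussian) + (\<integral>x. (infdist x C)\<^sup>2 \<partial>gaussian)"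
    by (intro Bochner_Integration.integral_add proj.integrable_F_square dist.integrable_F_square)
  also have "\<dots> \<le> (proj.mean\<^sup>2 + 28) + (dist.mean\<^sup>2 + 28)"
    by (intro add_mono proj.second_moment_le dist.second_moment_le)
  finally show ?thesis by simp
qed

text \<open>
  If \<open>y\<close> were outside the image of the truncated cone, a separating functional would violate the
  bound, since \<open>norm (P x)\<close> is the support function of that truncated cone.
\<close>

lemma ex_preimage:
  fixes A :: "'a \<Rightarrow> 'b::euclidean_space" and A' :: "'b \<Rightarrow> 'a"
  assumes lin: "linear A" and adj: "\<And>u v. A u \<bullet> v = u \<bullet> A' v"
    and \<rho>: "0 < \<rho>" and ge: "\<And>v. \<rho> * norm v \<le> norm (P (A' v))"
  obtains u where "u \<in> C" "A u = y" "norm u \<le> norm y / \<rho>"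
proof -
  let ?K = "A ` (C \<inter> cball 0 1)"
  have K: "z \<in> ?K" if z: "norm z \<le> \<rho>" for z
  proof (rule ccontr)
    assume "z \<notin> ?K"
    moreover have "convex ?K"
      by (intro convex_linear_image lin convex_Int convex convex_cball)
    moreover have "closed ?K"
      by (intro compact_imp_closed compact_continuous_image linear_continuous_on
          linear_conv_bounded_linear[THEN iffD1] lin closed_Int_compact closed compact_cball)
    ultimately obtain a b where ab: "a \<bullet> z < b" "\<And>k. k \<in> ?K \<Longrightarrow> b < a \<bullet> k"
      using separating_hyperplane_closed_point[of ?K z] by auto
    \<comment> \<open>The separating functional is large on the image and small at \<open>z\<close>,
      so \<open>- a\<close> is the direction to test. On the truncated cone its pullback attains the
      value \<open>norm p\<close> at the normalised \<open>p\<close>.\<close>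
    define p where "p = P (A' (- a))"
    have "p /\<^sub>R norm p \<in> C \<inter> cball 0 1"
      using norm_normalize_le[of p] by (simp add: p_def mem_scaleR P_mem)
    then have "b < a \<bullet> A (p /\<^sub>R norm p)" by (intro ab(2)) auto
    also have "a \<bullet> A (p /\<^sub>R norm p) = - (A (p /\<^sub>R norm p) \<bullet> (- a))"
      by (simp add: inner_commute)
    also have "\<dots> = - norm p"
      unfolding adj p_def by (simp only: inner_normalize[OF P_inner])
    finally have "norm p < - b" by simp
    also have "- b < - (a \<bullet> z)" using ab(1) by simp
    also have "\<dots> \<le> norm (- a) * norm z"
      using norm_cauchy_schwarz[of "- a" z] by simp
    also have "\<dots> \<le> \<rho> * norm (- a)"
      using z by (subst mult.commute) (intro mult_right_mono; simp)
    also have "\<dots> \<le> norm p" unfolding p_def by (rule ge)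
    finally show False by simp
  qed
  show thesis
  proof (cases "y = 0")
    case True
    with zero_mem lin show ?thesis by (intro that[of 0]) (auto simp: linear_0)
  next
    case False
    \<comment> \<open>Rescale \<open>y\<close> to norm \<open>\<rho>\<close>, find a preimage in the
      unit ball and scale back within the cone.\<close>
    have "norm ((\<rho> / norm y) *\<^sub>R y) \<le> \<rho>" using False \<rho> by simp
    from K[OF this] obtain k where k: "k \<in> C" "norm k \<le> 1" "A k = (\<rho> / norm y) *\<^sub>R y"
      by (elim imageE IntE) (simp add: eq_commute)
    show ?thesis
    proof (rule that[of "(norm y / \<rho>) *\<^sub>R k"])
      show "(norm y / \<rho>) *\<^sub>R k \<in> C" using k \<rho> by (intro mem_scaleR) auto
      show "A ((norm y / \<rho>) *\<^sub>R k) = y" using k False \<rho> by (simp add: linear_cmul[OF lin])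
      show "norm ((norm y / \<rho>) *\<^sub>R k) \<le> norm y / \<rho>"
        using mult_left_mono[OF k(2), of "norm y / \<rho>"] \<rho> by simp
    qed
  qed
qed

end

section \<open>Gaussian matrices\<close>

lemma (in prob_space) distributed_weighted_sum_std_normal:
  fixes X :: "'i::finite \<Rightarrow> 'a \<Rightarrow> real" and w :: "'i \<Rightarrow> real"
  assumes indep: "indep_vars (\<lambda>_. borel) X UNIV"
    and normal: "\<And>i. distributed M lborel (X i) std_normal_density"
    and w: "(\<Sum>i\<in>UNIV. (w i)\<^sup>2) = 1"
  shows "distributed M lborel (\<lambda>\<omega>. \<Sum>i\<in>UNIV. w i * X i \<omega>) std_normal_density"
proof -
  \<comment> \<open>Zero weights are dropped because \<open>sum_indep_normal\<close> needs summands
    of positive standard deviation.\<close>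
  let ?I = "{i. w i \<noteq> 0}"
  have wI: "(\<Sum>i\<in>?I. (w i)\<^sup>2) = 1"
    using w by (subst (asm) sum.mono_neutral_right[of _ ?I]) auto
  have "distributed M lborel (\<lambda>\<omega>. \<Sum>i\<in>?I. w i * X i \<omega>)
      (normal_density (\<Sum>i\<in>?I. 0) (sqrt (\<Sum>i\<in>?I. \<bar>w i\<bar>\<^sup>2)))"
  proof (rule sum_indep_normal)
    show "?I \<noteq> {}" using wI by force
    show "indep_vars (\<lambda>i. borel) (\<lambda>i \<omega>. w i * X i \<omega>) ?I"
      by (rule indep_vars_compose2[OF indep_vars_subset[OF indep]]) auto
    show "distributed M lborel (\<lambda>\<omega>. w i * X i \<omega>) (normal_density 0 \<bar>w i\<bar>)" if "i \<in> ?I" for i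
      using normal_density_affine[OF normal[of i], of "w i" 0] that by simp
  qed auto
  moreover have "(\<Sum>i\<in>?I. w i * X i \<omega>) = (\<Sum>i\<in>UNIV. w i * X i \<omega>)" for \<omega>
    by (rule sum.mono_neutral_left) auto
  ultimately show ?thesis using wI by simp
qed

text \<open>\<open>p\<close> arranges members of the family as a matrix. Its injectivity makes the
  index sets for different \<open>j\<close> disjoint, so the sums are independent, and a unit
  \<open>w\<close> keeps each standard normal. Pairing the indices in either order gives both
  \<open>v v* A\<close> and \<open>A *v x\<close>.\<close>

lemma (in prob_space) distr_weighted_sums_gaussian:
  fixes Z :: "'k \<Rightarrow> 'a \<Rightarrow> real" and p :: "'i::finite \<Rightarrow> 'j::finite \<Rightarrow> 'k" and w :: "real ^ 'i"
  assumes indep: "indep_vars (\<lambda>_. borel) Z UNIV"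
    and normal: "\<And>k. distributed M lborel (Z k) std_normal_density"
    and p: "\<And>i j i' j'. p i j = p i' j' \<Longrightarrow> i = i' \<and> j = j'"
    and w: "norm w = 1"
  shows "random_variable borel (\<lambda>\<omega>. \<chi> j. \<Sum>i\<in>UNIV. w $ i * Z (p i j) \<omega>)"
    and "distr M borel (\<lambda>\<omega>. \<chi> j. \<Sum>i\<in>UNIV. w $ i * Z (p i j) \<omega>) = (gaussian :: (real ^ 'j) measure)"
proof -
  define X where "X j \<omega> = (\<Sum>i\<in>UNIV. w $ i * Z (p i j) \<omega>)" for j \<omega>
  let ?K = "\<lambda>j. range (\<lambda>i. p i j)"
  have "indep_vars (\<lambda>j. PiM (?K j) (\<lambda>_. borel)) (\<lambda>j \<omega>. restrict (\<lambda>k. Z k \<omega>) (?K j)) UNIV"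
    using p by (intro indep_vars_restrict[OF indep]) (auto simp: disjoint_family_on_def)
  then have "indep_vars (\<lambda>_. borel) (\<lambda>j \<omega>. (\<lambda>f. \<Sum>i\<in>UNIV. w $ i * f (p i j)) (restrict (\<lambda>k. Z k \<omega>) (?K j))) UNIV"
    by (rule indep_vars_compose2) (auto intro!: borel_measurable_sum borel_measurable_times measurable_component_singleton)
  then have indepX: "indep_vars (\<lambda>_. borel) X UNIV"
    by (simp add: X_def[abs_def])
  have w2: "(\<Sum>i\<in>UNIV. (w $ i)\<^sup>2) = 1"
    using w by (simp add: norm_vec_def L2_set_def)
  have normalX: "distributed M lborel (X j) std_normal_density" for j
  proof -
    have "indep_vars (\<lambda>i. PiM {p i j} (\<lambda>_. borel)) (\<lambda>i \<omega>. restrict (\<lambda>k. Z k \<omega>) {p i j}) UNIV"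
      using p by (intro indep_vars_restrict[OF indep]) (auto simp: disjoint_family_on_def)
    then have "indep_vars (\<lambda>_. borel) (\<lambda>i \<omega>. (\<lambda>f. f (p i j)) (restrict (\<lambda>k. Z k \<omega>) {p i j})) UNIV"
      by (rule indep_vars_compose2) (auto intro!: measurable_component_singleton)
    then have "indep_vars (\<lambda>_. borel) (\<lambda>i. Z (p i j)) UNIV"
      by simp
    from distributed_weighted_sum_std_normal[OF this normal w2]
    show ?thesis by (simp add: X_def[abs_def])
  qed
  have rvX [measurable]: "random_variable borel (X j)" for j
    using normalX[of j] by (simp add: distributed_def)
  have dX: "distr M borel (X j) = density lborel (\<lambda>x. ennreal (std_normal_density x))" for j
    using distributed_distr_eq_density[OF normalX[of j]]
    by (simp cong: distr_cong)
  let ?D = "\<Pi>\<^sub>M j\<in>(UNIV::'j set). density lborel (\<lambda>x. ennreal (std_normal_density x))"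
  have "distr M (\<Pi>\<^sub>M j\<in>UNIV. borel) (\<lambda>\<omega>. \<lambda>j\<in>UNIV. X j \<omega>) = (\<Pi>\<^sub>M j\<in>UNIV. distr M borel (X j))"
    using indepX rvX by (subst (asm) indep_vars_iff_distr_eq_PiM) auto
  also have "\<dots> = ?D" by (simp add: dX)
  finally have joint: "distr M (\<Pi>\<^sub>M j\<in>UNIV. borel) (\<lambda>\<omega>. \<lambda>j. X j \<omega>) = ?D"
    by (simp only: restrict_UNIV)
  have X: "(\<lambda>\<omega> j. X j \<omega>) \<in> measurable M (\<Pi>\<^sub>M j\<in>UNIV. borel)"
    by (rule measurable_PiM_single') simp_all
  have "gaussian = distr ?D borel (\<lambda>g. (\<chi> j. g j) :: real^'j)"
    by (rule distr_PiM_gaussian(2)[symmetric])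
  also have "\<dots> = distr M borel ((\<lambda>g. (\<chi> j. g j) :: real^'j) \<circ> (\<lambda>\<omega> j. X j \<omega>))"
    unfolding joint[symmetric]
    by (rule distr_distr[OF measurable_vec_lambda_PiM X])
  finally show "distr M borel (\<lambda>\<omega>. \<chi> j. \<Sum>i\<in>UNIV. w $ i * Z (p i j) \<omega>) = (gaussian :: (real ^ 'j) measure)"
    by (simp add: comp_def X_def)
  show "random_variable borel (\<lambda>\<omega>. \<chi> j. \<Sum>i\<in>UNIV. w $ i * Z (p i j) \<omega>)"
    using measurable_comp[OF X measurable_vec_lambda_PiM] by (simp add: comp_def X_def)
qed

section \<open>Norms, their Lipschitz constants and admissible objectives\<close>

lemma is_norm_zero: "is_norm N \<Longrightarrow> N 0 = 0"
  unfolding is_norm_def by blast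

lemma is_norm_sum_le:
  assumes "is_norm N" "finite S"
  shows "N (\<Sum>i\<in>S. f i) \<le> (\<Sum>i\<in>S. N (f i))"
  using assms(2)
proof induction
  case empty
  show ?case by (simp add: is_norm_zero[OF assms(1)])
next
  case (insert i S)
  have "N (f i + (\<Sum>i\<in>S. f i)) \<le> N (f i) + N (\<Sum>i\<in>S. f i)"
    using assms(1) by (simp add: is_norm_def)
  with insert show ?case by simp
qed

text \<open>A real \<open>SUP\<close> is informative only for a set bounded above. Expanding in the
  standard basis bounds \<open>N\<close> by a multiple of the Euclidean norm, hence bounds the
  quotients; the claim is then the quotient at \<open>(z, 0)\<close>.\<close>

lemma is_norm_le_lipschitz_const:
  fixes N :: "real ^ 'n \<Rightarrow> real"
  assumes N: "is_norm N"
  shows "N z \<le> lipschitz_const N * norm z"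
proof (cases "z = 0")
  case True
  then show ?thesis by (simp add: is_norm_zero[OF N])
next
  case False
  define B where "B = (\<Sum>i\<in>UNIV. N (axis i 1))"
  have N_scale: "N (c *\<^sub>R x) = \<bar>c\<bar> * N x" and N_nonneg: "0 \<le> N x"
    and N_add: "N (x + y) \<le> N x + N y" for c x y
    using N by (auto simp: is_norm_def)
  have NB: "N x \<le> B * norm x" for x
  proof -
    have "N x = N (\<Sum>i\<in>UNIV. x $ i *\<^sub>R axis i 1)"
      using basis_expansion[of x] by (simp add: scalar_mult_eq_scaleR)
    also have "\<dots> \<le> (\<Sum>i\<in>UNIV. N (x $ i *\<^sub>R axis i 1))"
      by (intro is_norm_sum_le N) simp
    also have "\<dots> \<le> (\<Sum>i\<in>UNIV. norm x * N (axis i 1))"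
      by (intro sum_mono) (simp add: N_scale N_nonneg mult_right_mono component_le_norm_cart)
    finally show ?thesis by (simp add: B_def sum_distrib_left mult.commute)
  qed
  let ?S = "{(z1, z2). z1 \<noteq> z2} :: ((real ^ 'n) \<times> (real ^ 'n)) set"
  have "bdd_above ((\<lambda>(z1, z2). (N z1 - N z2) / norm (z1 - z2)) ` ?S)"
  proof (rule bdd_aboveI2)
    fix p assume "p \<in> ?S"
    then obtain z1 z2 where p: "p = (z1, z2)" "z1 \<noteq> z2" by auto
    have "N z1 - N z2 \<le> N (z1 - z2)" using N_add[of "z1 - z2" z2] by simp
    also have "\<dots> \<le> B * norm (z1 - z2)" by (rule NB)
    finally show "(case p of (z1, z2) \<Rightarrow> (N z1 - N z2) / norm (z1 - z2)) \<le> B"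
      using p by (simp add: pos_divide_le_eq)
  qed
  moreover have "(z, 0) \<in> ?S" using False by simp
  ultimately have "(case (z, 0) of (z1, z2) \<Rightarrow> (N z1 - N z2) / norm (z1 - z2)) \<le> lipschitz_const N"
    unfolding lipschitz_const_def by (rule cSUP_upper[rotated])
  then show ?thesis using False by (simp add: is_norm_zero[OF N] pos_divide_le_eq)
qed

lemma lipschitz_const_pos:
  fixes N :: "real ^ 'n \<Rightarrow> real"
  assumes N: "is_norm N"
  shows "0 < lipschitz_const N"
proof -
  let ?e = "axis undefined 1 :: real ^ 'n"
  have "?e \<noteq> 0" by (simp add: axis_eq_0_iff)
  then have "N ?e \<noteq> 0" "0 \<le> N ?e" using N by (simp_all add: is_norm_def)
  with is_norm_le_lipschitz_const[OF N, of ?e] show ?thesis by simp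
qed

lemma kappa_nonneg: "is_norm N \<Longrightarrow> 0 \<le> kappa N x"
  using lipschitz_const_pos[of N] by (simp add: kappa_def is_norm_def)

lemma kappa_le_1:
  assumes N: "is_norm N"
  shows "kappa N x \<le> 1"
proof -
  have "N (x /\<^sub>R norm x) \<le> lipschitz_const N * norm (x /\<^sub>R norm x)"
    by (rule is_norm_le_lipschitz_const[OF N])
  also have "\<dots> \<le> lipschitz_const N * 1"
    using lipschitz_const_pos[OF N] by (intro mult_left_mono norm_normalize_le) simp
  finally show ?thesis using lipschitz_const_pos[OF N] by (simp add: kappa_def)
qed

text \<open>Coordinates are switched from \<open>z\<close> to \<open>z'\<close> one at a time. The
  strictly increasing one goes first, and the others cannot undo the gain.\<close>

lemma admissible_less:
  fixes h :: "real ^ 't::finite \<Rightarrow> real"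
  assumes h: "admissible h" and z: "z \<in> nonneg_orthant" and less: "\<And>i. z $ i < z' $ i"
  shows "h z < h z'"
proof -
  define mix where "mix S = (\<chi> j. if j \<in> S then z' $ j else z $ j)" for S
  have z0: "0 \<le> z $ i" "0 \<le> z' $ i" for i
    using z less[of i] by (auto simp: nonneg_orthant_def intro: order_trans less_imp_le)
  have orth: "mix S \<in> nonneg_orthant" for S
    using z0 by (simp add: nonneg_orthant_def mix_def)
  have ins: "mix (insert k S) = (\<chi> j. if j = k then z' $ k else mix S $ j)" for k S
    by (auto simp: mix_def vec_eq_iff)
  have nins: "mix S = (\<chi> j. if j = k then z $ k else mix S $ j)" if "k \<notin> S" for k S
    using that by (auto simp: mix_def vec_eq_iff)
  have mono: "h (mix S) \<le> h (mix (insert k S))" for k S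
  proof (cases "k \<in> S")
    case False
    have "mono_on {0..} (\<lambda>s. h (\<chi> j. if j = k then s else mix S $ j))"
      using h orth by (auto simp: admissible_def)
    from mono_onD[OF this, of "z $ k" "z' $ k"] show ?thesis
      unfolding ins using nins[OF False] z0 less[of k] by simp
  qed (simp add: insert_absorb)
  obtain i where i: "\<And>z. z \<in> nonneg_orthant \<Longrightarrow> strict_mono_on {0..} (\<lambda>s. h (\<chi> j. if j = i then s else z $ j))"
    using h unfolding admissible_def by blast
  have chain: "h (mix {i}) \<le> h (mix (insert i S))" if "finite S" for S
    using that
  proof induction
    case (insert k S)
    then show ?case using mono[of "insert i S" k] by (simp add: insert_commute)
  qed simp
  have "h (mix {}) < h (mix {i})"
    using strict_mono_onD[OF i[OF orth[of "{}"]], of "z $ i" "z' $ i"] z0 less[of i]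
    unfolding ins using nins[of i "{}"] by simp
  also have "\<dots> \<le> h (mix UNIV)"
    using chain[of UNIV] by simp
  finally show ?thesis by (simp add: mix_def)
qed

lemma not_is_minimizerI:
  fixes N :: "'t::finite \<Rightarrow> real ^ 'n \<Rightarrow> real"
  assumes C: "convex_cone C" and x0: "x0 \<noteq> 0" and N: "\<And>i. is_norm (N i)" and h: "admissible h"
    and u: "u \<in> C" "A *v u = A *v (x0 /\<^sub>R norm x0)" "norm u < kappa_min N x0"
  shows "\<not> is_minimizer C N h A x0"
proof -
  let ?x = "norm x0 *\<^sub>R u"
  have "?x \<in> C" using C u(1) by (simp add: convex_cone_def conic_def)
  moreover have "A *v ?x = A *v x0"
    using u(2) x0 by (simp add: scaleR_matrix_vector_assoc[symmetric] matrix_vector_mult_scaleR)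
  moreover have "h (\<chi> i. N i ?x) < h (\<chi> i. N i x0)"
  proof (rule admissible_less[OF h])
    show "(\<chi> i. N i ?x) \<in> nonneg_orthant"
      using N by (simp add: nonneg_orthant_def is_norm_def)
    fix i
    have N_scale: "N i (c *\<^sub>R x) = \<bar>c\<bar> * N i x" for c x
      using N[of i] by (simp add: is_norm_def)
    note L = lipschitz_const_pos[OF N[of i]]
    have "N i u \<le> lipschitz_const (N i) * norm u"
      by (rule is_norm_le_lipschitz_const[OF N])
    also have "\<dots> < lipschitz_const (N i) * kappa (N i) x0"
    proof (rule mult_strict_left_mono[OF _ L])
      have "kappa_min N x0 \<le> kappa (N i) x0" by (simp add: kappa_min_def)
      with u(3) show "norm u < kappa (N i) x0" by simp
    qed
    also have "\<dots> = N i (x0 /\<^sub>R norm x0)" using L by (simp add: kappa_def)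
    finally have "norm x0 * N i u < norm x0 * N i (x0 /\<^sub>R norm x0)"
      using x0 by (intro mult_strict_left_mono) simp_all
    also have "\<dots> = N i x0" using N_scale[of "norm x0" "x0 /\<^sub>R norm x0"] x0 by simp
    finally show "(\<chi> i. N i ?x) $ i < (\<chi> i. N i x0) $ i"
      by (simp add: N_scale)
  qed
  ultimately show ?thesis
    unfolding is_minimizer_def is_arg_min_def by auto
qed

section \<open>Probability estimates for the Gaussian matrix\<close>

text \<open>Markov's inequality for \<open>exp ((norm x)^2 / 4)\<close>, with \<open>sqrt 2\<close>
  relaxed to \<open>exp (1 / 2)\<close> in its moment.\<close>

lemma gaussian_norm_tail:
  assumes "0 \<le> r"
  shows "measure (gaussian :: 'a::euclidean_space measure) {x. r \<le> norm x} \<le> exp (real DIM('a) / 2 - r\<^sup>2 / 4)"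
proof -
  have "{x :: 'a. r \<le> norm x} = {x \<in> space gaussian. exp (r\<^sup>2 / 4) \<le> exp ((norm x)\<^sup>2 / 4)}"
    using assms by (auto simp: abs_le_square_iff[symmetric])
  then have "measure (gaussian :: 'a measure) {x. r \<le> norm x} \<le>
      (\<integral>x. exp ((norm x)\<^sup>2 / 4) \<partial>(gaussian :: 'a measure)) / exp (r\<^sup>2 / 4)"
    using integral_Markov_inequality_measure[OF integrable_exp_quarter_gaussian, of "{}" "exp (r\<^sup>2 / 4)"]
    by simp
  also have "(\<integral>x. exp ((norm x)\<^sup>2 / 4) \<partial>(gaussian :: 'a measure)) = sqrt 2 ^ DIM('a)"
    by (intro integral_eq_nn_integral[THEN trans]) (simp_all add: nn_integral_exp_quarter_gaussian)
  also have "sqrt 2 ^ DIM('a) \<le> exp (1 / 2) ^ DIM('a)"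
  proof (rule power_mono)
    have "sqrt 2 \<le> 3 / 2" by (rule real_le_lsqrt) (simp_all add: power2_eq_square)
    also have "\<dots> \<le> exp (1 / 2)" using exp_ge_add_one_self[of "1 / 2"] by simp
    finally show "sqrt 2 \<le> exp (1 / 2)" .
  qed simp
  also have "exp (1 / 2) ^ DIM('a) = exp (real DIM('a) / 2)"
    by (simp flip: exp_of_nat_mult)
  finally show ?thesis by (simp add: divide_right_mono exp_diff)
qed

lemma std_gaussian_matrix_mult_vec:
  fixes A :: "'w \<Rightarrow> real ^ 'n ^ 'm"
  assumes M: "prob_space M" and A: "std_gaussian_matrix M A" and x: "norm x = 1"
  shows "(\<lambda>\<omega>. A \<omega> *v x) \<in> measurable M borel" and "distr M borel (\<lambda>\<omega>. A \<omega> *v x) = gaussian"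
proof -
  interpret prob_space M by fact
  let ?Z = "\<lambda>(i, j) \<omega>. A \<omega> $ i $ j"
  have indep: "indep_vars (\<lambda>_. borel) ?Z UNIV"
    using A by (simp add: std_gaussian_matrix_def)
  have normal: "distributed M lborel (?Z k) std_normal_density" for k
    using A by (cases k) (simp add: std_gaussian_matrix_def)
  have eq: "(\<lambda>\<omega>. \<chi> i. \<Sum>j\<in>UNIV. x $ j * ?Z (i, j) \<omega>) = (\<lambda>\<omega>. A \<omega> *v x)"
    by (simp add: matrix_vector_mult_def mult.commute)
  show "(\<lambda>\<omega>. A \<omega> *v x) \<in> measurable M borel" "distr M borel (\<lambda>\<omega>. A \<omega> *v x) = gaussian"
    using distr_weighted_sums_gaussian[OF indep normal _ x, where p = "\<lambda>j i. (i, j)"]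
    unfolding eq by auto
qed

lemma std_gaussian_matrix_vec_mult:
  fixes A :: "'w \<Rightarrow> real ^ 'n ^ 'm"
  assumes M: "prob_space M" and A: "std_gaussian_matrix M A" and v: "norm v = 1"
  shows "(\<lambda>\<omega>. v v* A \<omega>) \<in> measurable M borel" and "distr M borel (\<lambda>\<omega>. v v* A \<omega>) = gaussian"
proof -
  interpret prob_space M by fact
  let ?Z = "\<lambda>(i, j) \<omega>. A \<omega> $ i $ j"
  have indep: "indep_vars (\<lambda>_. borel) ?Z UNIV"
    using A by (simp add: std_gaussian_matrix_def)
  have normal: "distributed M lborel (?Z k) std_normal_density" for k
    using A by (cases k) (simp add: std_gaussian_matrix_def)
  have eq: "(\<lambda>\<omega>. \<chi> j. \<Sum>i\<in>UNIV. v $ i * ?Z (i, j) \<omega>) = (\<lambda>\<omega>. v v* A \<omega>)"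
    by (simp add: vector_matrix_mult_def mult.commute)
  show "(\<lambda>\<omega>. v v* A \<omega>) \<in> measurable M borel" "distr M borel (\<lambda>\<omega>. v v* A \<omega>) = gaussian"
    using distr_weighted_sums_gaussian[OF indep normal _ v, where p = "\<lambda>i j. (i, j)"]
    unfolding eq by auto
qed

lemma gaussian_distance_eq:
  fixes S :: "(real ^ 'n) set"
  shows "gaussian_distance S = (\<integral>x. infdist x S \<partial>gaussian)"
proof -
  have "(\<lambda>x. infdist x S) \<in> borel_measurable borel"
    by (intro borel_measurable_continuous_onI continuous_on_infdist continuous_on_id)
  from integral_distr[OF distr_PiM_gaussian(1) this] show ?thesis
    by (simp only: gaussian_distance_def distr_PiM_gaussian(2))
qed

text \<open>Outside two bad events, \<open>norm (A x)\<close> being large and the projection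
  deviating at some net point, \<open>ex_preimage\<close> applies with radius
  \<open>\<mu> / 5\<close>. They contribute one and two times \<open>exp (- q / 16)\<close>.\<close>

lemma gaussian_matrix_small_preimage:
  fixes C :: "(real ^ 'n) set" and A :: "'w \<Rightarrow> real ^ 'n ^ 'm"
  assumes C: "closed C" "convex_cone C" and x: "norm x = 1"
    and M: "prob_space M" and A: "std_gaussian_matrix M A"
    and k: "0 < k" "k \<le> 1"
    and q: "32 \<le> q" and dim: "real CARD('m) \<le> q"
    and D: "100 * q \<le> k\<^sup>2 * (real CARD('n) - (gaussian_distance C)\<^sup>2)"
  obtains E where "E \<in> sets M" "1 - 3 * exp (- q / 16) \<le> measure M E"
    and "\<And>\<omega>. \<omega> \<in> E \<Longrightarrow> \<exists>u\<in>C. A \<omega> *v u = A \<omega> *v x \<and> norm u < k"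
proof -
  interpret prob_space M by (rule M)
  interpret closed_convex_cone C by standard (rule C)+
  define \<mu> where "\<mu> = proj.mean"
  have "0 \<le> \<mu>" by (simp add: \<mu>_def integral_nonneg)
  have k2: "k\<^sup>2 \<le> 1" using k by (simp add: power_le_one)
  \<comment> \<open>The loss of \<open>56 * k^2\<close> from \<open>mean_square_ge\<close> is at
    most \<open>2 * q\<close>, as \<open>k \<le> 1\<close> and \<open>q \<ge> 32\<close>.\<close>
  have k\<mu>: "98 * q \<le> k\<^sup>2 * \<mu>\<^sup>2"
  proof -
    have "real CARD('n) - (gaussian_distance C)\<^sup>2 - 56 \<le> \<mu>\<^sup>2"
      using mean_square_ge by (simp add: \<mu>_def gaussian_distance_eq)
    then have "k\<^sup>2 * (real CARD('n) - (gaussian_distance C)\<^sup>2 - 56) \<le> k\<^sup>2 * \<mu>\<^sup>2"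
      by (intro mult_left_mono) simp_all
    with D k2 q show ?thesis by (simp add: right_diff_distrib)
  qed
  have \<mu>2: "98 * q \<le> \<mu>\<^sup>2"
    using k\<mu> mult_right_mono[OF k2, of "\<mu>\<^sup>2"] by simp
  with q \<open>0 \<le> \<mu>\<close> have \<mu>: "0 < \<mu>" by (cases "\<mu> = 0") auto
  obtain T :: "(real ^ 'm) set" where T: "finite T" "T \<subseteq> sphere 0 1" "real (card T) \<le> 13 ^ CARD('m)"
    and net: "\<And>v. norm v = 1 \<Longrightarrow> \<exists>w\<in>T. norm (v - w) \<le> 1 / 6"
    using sphere_net[where e = "1 / 6" and 'a = "real ^ 'm"] by auto
  have T1: "norm w = 1" if "w \<in> T" for w using T that by auto
  define B0 where "B0 = {\<omega> \<in> space M. k * \<mu> / 5 \<le> norm (A \<omega> *v x)}"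
  define B where "B w = {\<omega> \<in> space M. \<mu> / 2 \<le> \<bar>norm (P (w v* A \<omega>)) - \<mu>\<bar>}" for w
  note Ax = std_gaussian_matrix_mult_vec[OF M A x]
  note Aw = std_gaussian_matrix_vec_mult[OF M A T1]
  have B0_sets: "B0 \<in> sets M"
    unfolding B0_def using Ax(1) by measurable
  have B_sets: "B w \<in> sets M" if "w \<in> T" for w
    unfolding B_def using Aw(1)[OF that] by measurable
  have "measure M B0 = measure (distr M borel (\<lambda>\<omega>. A \<omega> *v x)) {y. k * \<mu> / 5 \<le> norm y}"
    using Ax(1) by (subst measure_distr) (auto simp: B0_def vimage_def Int_def conj_commute)
  also have "\<dots> \<le> exp (real CARD('m) / 2 - (k * \<mu> / 5)\<^sup>2 / 4)"
    unfolding Ax(2) using gaussian_norm_tail[of "k * \<mu> / 5", where 'a = "real ^ 'm"] k \<mu> by simp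
  \<comment> \<open>The exponent is at most \<open>q / 2 - 98 * q / 100\<close>, well below
    \<open>- q / 16\<close>.\<close>
  also have "\<dots> \<le> exp (- q / 16)"
    using k\<mu> dim q by (simp add: power_mult_distrib power_divide)
  finally have B0: "measure M B0 \<le> exp (- q / 16)" .
  have B: "measure M (B w) \<le> 2 * exp (- (\<mu> / 2)\<^sup>2 / 8)" if w: "w \<in> T" for w
  proof -
    have "measure M (B w) = measure (distr M borel (\<lambda>\<omega>. w v* A \<omega>)) {y. \<mu> / 2 \<le> \<bar>norm (P y) - \<mu>\<bar>}"
      using Aw(1)[OF w] by (subst measure_distr) (auto simp: B_def vimage_def Int_def conj_commute)
    also have "\<dots> \<le> 2 * exp (- (\<mu> / 2)\<^sup>2 / 8)"
      unfolding Aw(2)[OF w] \<mu>_def using \<mu> by (intro proj.concentration) (simp add: \<mu>_def)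
    finally show ?thesis .
  qed
  have e3: "13 \<le> exp (3 :: real)"
  proof -
    have "(5 / 2 :: real) ^ 3 \<le> exp 1 ^ 3"
      using exp_lower_Taylor_quadratic[of 1] by (intro power_mono) simp_all
    also have "\<dots> = exp 3" by (simp flip: exp_of_nat_mult)
    finally show ?thesis by (simp add: power3_eq_cube)
  qed
  have "measure M (\<Union>w\<in>T. B w) \<le> (\<Sum>w\<in>T. measure M (B w))"
    using B_sets T(1) by (intro finite_measure_subadditive_finite) auto
  also have "\<dots> \<le> (\<Sum>w\<in>T. 2 * exp (- (\<mu> / 2)\<^sup>2 / 8))"
    by (intro sum_mono B)
  also have "\<dots> = card T * (2 * exp (- (\<mu> / 2)\<^sup>2 / 8))"
    by simp
  \<comment> \<open>The net has at most \<open>13 ^ m \<le> exp (3 * q)\<close> points, and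
    \<open>98 / 32 = 3 + 1 / 16\<close>: concentration beats the union bound by exactly
    \<open>exp (- q / 16)\<close>.\<close>
  also have "\<dots> \<le> exp (3 * q) * (2 * exp (- (98 * q) / 32))"
  proof (intro mult_mono)
    have "real (card T) \<le> 13 ^ CARD('m)" by (rule T(3))
    also have "\<dots> \<le> exp 3 ^ CARD('m)" using e3 by (intro power_mono) auto
    also have "\<dots> = exp (3 * real CARD('m))" by (simp add: mult.commute flip: exp_of_nat_mult)
    also have "\<dots> \<le> exp (3 * q)" using dim by simp
    finally show "real (card T) \<le> exp (3 * q)" .
    show "exp (- (\<mu> / 2)\<^sup>2 / 8) \<le> exp (- (98 * q) / 32)"
      using \<mu>2 by (simp add: power_divide)
  qed auto
  also have "\<dots> = 2 * exp (- q / 16)"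
    by (simp add: field_simps flip: exp_add)
  finally have BT: "measure M (\<Union>w\<in>T. B w) \<le> 2 * exp (- q / 16)" .
  show thesis
  proof (rule that[of "space M - (B0 \<union> (\<Union>w\<in>T. B w))"])
    have sets: "B0 \<union> (\<Union>w\<in>T. B w) \<in> sets M"
      using B0_sets B_sets T(1) by (intro sets.Un sets.finite_UN) auto
    then show "space M - (B0 \<union> (\<Union>w\<in>T. B w)) \<in> sets M" by auto
    have "measure M (B0 \<union> (\<Union>w\<in>T. B w)) \<le> measure M B0 + measure M (\<Union>w\<in>T. B w)"
      using B0_sets B_sets T(1) by (intro measure_Un_le sets.finite_UN) auto
    then show "1 - 3 * exp (- q / 16) \<le> measure M (space M - (B0 \<union> (\<Union>w\<in>T. B w)))"
      using B0 BT by (simp add: prob_compl[OF sets])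
    fix \<omega> assume \<omega>: "\<omega> \<in> space M - (B0 \<union> (\<Union>w\<in>T. B w))"
    have small: "norm (A \<omega> *v x) < k * \<mu> / 5"
      using \<omega> by (auto simp: B0_def)
    have ge: "\<mu> / 5 * norm v \<le> norm (P (v v* A \<omega>))" for v
    proof (rule sublinear_ge_of_net[where T = T and r = "\<lambda>v. norm (P (v v* A \<omega>))"])
      fix v w :: "real ^ 'm" and c :: real
      show "norm (P ((v + w) v* A \<omega>)) \<le> norm (P (v v* A \<omega>)) + norm (P (w v* A \<omega>))"
        using proj.F_add_le by (simp add: vector_matrix_left_distrib)
      show "norm (P ((c *\<^sub>R v) v* A \<omega>)) = c * norm (P (v v* A \<omega>))" if "0 \<le> c"
        using proj.F_scaleR[OF that] by (simp add: scaleR_vector_matrix_assoc)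
      show "norm v = 1 \<Longrightarrow> \<exists>w\<in>T. norm (v - w) \<le> 1 / 6" by (rule net)
      have "norm (P (v v* A \<omega>)) \<le> norm (v v* A \<omega>)"
        using proj.abs_F_le by simp
      also have "\<dots> \<le> onorm (\<lambda>v. v v* A \<omega>) * norm v"
        by (intro onorm linear_conv_bounded_linear[THEN iffD1] linearI)
          (simp_all add: vector_matrix_left_distrib scaleR_vector_matrix_assoc)
      finally show "norm (P (v v* A \<omega>)) \<le> onorm (\<lambda>v. v v* A \<omega>) * norm v" .
      show "\<bar>norm (P (w v* A \<omega>)) - \<mu>\<bar> \<le> \<mu> / 2" if "w \<in> T"
        using \<omega> that by (force simp: B_def)
    qed
    have "0 < \<mu> / 5" using \<mu> by simp
    have adj: "(A \<omega> *v u) \<bullet> v = u \<bullet> (v v* A \<omega>)" for u v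
      using dot_lmul_matrix[of v "A \<omega>" u] by (simp only: inner_commute)
    obtain u where u: "u \<in> C" "A \<omega> *v u = A \<omega> *v x" "norm u \<le> norm (A \<omega> *v x) / (\<mu> / 5)"
      by (rule ex_preimage[OF matrix_vector_mul_linear adj \<open>0 < \<mu> / 5\<close> ge])
    have "norm (A \<omega> *v x) / (\<mu> / 5) < k" using small \<mu> by (simp add: field_simps)
    with u show "\<exists>u\<in>C. A \<omega> *v u = A \<omega> *v x \<and> norm u < k"
      by (intro bexI[of _ u]) auto
  qed
qed

theorem theorem3p2:
  fixes C :: "(real ^ 'n) set"
    and x0 :: "real ^ 'n"
    and N :: "'t::finite \<Rightarrow> real ^ 'n \<Rightarrow> real"
    and M :: "'w measure"
    and A :: "'w \<Rightarrow> real ^ 'n ^ 'm"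
  assumes "closed C" and "convex_cone C"
    and "x0 \<in> C" and "x0 \<noteq> 0"
    and "\<And>i. is_norm (N i)"
    and "prob_space M" and "std_gaussian_matrix M A"
    and "real CARD('m) \<le> m_low C N x0"
  shows "with_prob_at_least M
           (1 - 10 * exp (- (1 / 16) * min (m_low C N x0)
              ((1 - normalized_gaussian_distance C)\<^sup>2 * real CARD('n))))
           (\<lambda>\<omega>. \<forall>h. admissible h \<longrightarrow> \<not> is_minimizer C N h (A \<omega>) x0)"
proof -
  define q where "q = m_low C N x0"
  define k where "k = kappa_min N x0"
  define d where "d = normalized_gaussian_distance C"
  define r where "r = min q ((1 - d)\<^sup>2 * real CARD('n))"
  have "with_prob_at_least M (1 - 10 * exp (- (1 / 16) * r))
      (\<lambda>\<omega>. \<forall>h. admissible h \<longrightarrow> \<not> is_minimizer C N h (A \<omega>) x0)"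
  proof (cases "r \<le> 32")
    case True \<comment> \<open>the claimed probability is not positive\<close>
    have "exp 2 \<le> (272 / 100 :: real)\<^sup>2"
      unfolding exp_double[of 1, simplified] using e_less_272 by (intro power_mono) auto
    then have "exp 2 \<le> (10 :: real)" by (simp add: power2_eq_square)
    then have "1 \<le> 10 * exp (- 2 :: real)" by (simp add: exp_minus field_simps)
    also have "\<dots> \<le> 10 * exp (- (1 / 16) * r)" using True by simp
    finally show ?thesis unfolding with_prob_at_least_def by (intro bexI[of _ "{}"]) auto
  next
    case False
    then have q: "32 \<le> q" by (simp add: r_def)
    have q_eq: "100 * q = (1 - d) * real CARD('n) * k\<^sup>2"
      by (simp add: q_def m_low_def d_def k_def)
    have "0 \<le> k"
      using assms(5) kappa_nonneg by (auto simp: k_def kappa_min_def)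
    have "k \<le> kappa (N i) x0" for i
      by (simp add: k_def kappa_min_def)
    then have "k \<le> 1"
      using kappa_le_1[OF assms(5)] by (rule order_trans)
    \<comment> \<open>A vanishing \<open>k\<close> would force \<open>q = 0\<close>, against
      \<open>q \<ge> 32\<close>; the sign of \<open>1 - d\<close> follows from the same
      identity.\<close>
    have "k \<noteq> 0" using q q_eq by auto
    with \<open>0 \<le> k\<close> have "0 < k" by simp
    have "0 < 1 - d"
    proof (rule ccontr)
      assume "\<not> 0 < 1 - d"
      then have "(1 - d) * real CARD('n) * k\<^sup>2 \<le> 0"
        by (intro mult_nonpos_nonneg) auto
      with q q_eq show False by simp
    qed
    have "0 \<le> d"
      by (simp add: d_def normalized_gaussian_distance_def gaussian_distance_def
          integral_nonneg infdist_nonneg)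
    have "(gaussian_distance C)\<^sup>2 = d\<^sup>2 * real CARD('n)"
      by (simp add: d_def normalized_gaussian_distance_def power_divide)
    \<comment> \<open>The factorisation \<open>1 - d^2 = (1 - d) + d * (1 - d)\<close> bounds the
      quadratic deficit below by the linear one appearing in \<open>m_low\<close>.\<close>
    then have "real CARD('n) - (gaussian_distance C)\<^sup>2 = (1 - d) * real CARD('n) + d * (1 - d) * real CARD('n)"
      by (simp add: power2_eq_square algebra_simps)
    also have "\<dots> \<ge> (1 - d) * real CARD('n)"
      using \<open>0 \<le> d\<close> \<open>0 < 1 - d\<close> by simp
    finally have "k\<^sup>2 * ((1 - d) * real CARD('n)) \<le> k\<^sup>2 * (real CARD('n) - (gaussian_distance C)\<^sup>2)"
      by (intro mult_left_mono) simp_all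
    moreover have "100 * q = k\<^sup>2 * ((1 - d) * real CARD('n))"
      unfolding q_eq by (rule mult.commute)
    ultimately have D: "100 * q \<le> k\<^sup>2 * (real CARD('n) - (gaussian_distance C)\<^sup>2)"
      by (simp only:)
    have x: "norm (x0 /\<^sub>R norm x0) = 1" using assms(4) by simp
    obtain E where E: "E \<in> sets M" "1 - 3 * exp (- q / 16) \<le> measure M E"
      "\<And>\<omega>. \<omega> \<in> E \<Longrightarrow> \<exists>u\<in>C. A \<omega> *v u = A \<omega> *v (x0 /\<^sub>R norm x0) \<and> norm u < k"
      using gaussian_matrix_small_preimage[OF assms(1,2) x assms(6,7) \<open>0 < k\<close> \<open>k \<le> 1\<close> q _ D] assms(8)
      by (auto simp: q_def)
    have "3 * exp (- q / 16) \<le> 10 * exp (- (1 / 16) * r)"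
      by (intro mult_mono) (auto simp: r_def)
    with E(2) have "1 - 10 * exp (- (1 / 16) * r) \<le> measure M E" by simp
    \<comment> \<open>The preimage \<open>u\<close> depends on the outcome but not on
      \<open>h\<close>, so one measurable event serves the uncountable family of objectives.\<close>
    moreover have "E \<subseteq> {\<omega> \<in> space M. \<forall>h. admissible h \<longrightarrow> \<not> is_minimizer C N h (A \<omega>) x0}"
      using E(3) sets.sets_into_space[OF E(1)] not_is_minimizerI[where N = N, OF assms(2,4,5)]
      unfolding k_def by blast
    ultimately show ?thesis
      unfolding with_prob_at_least_def using E(1) by blast
  qed
  then show ?thesis by (simp only: r_def q_def d_def)
qed

end
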